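(* Let $U,n_t$ be positive integers. For every code $C_{U,n_t}\in\mathfrak{C}_{U,n_t}$ there exist constants $c_1>0$ and $c_2>0$ such that $$ \frac{c_1}{N^{(U-1)n_t}}\ \le\ D(N_1=N,\,N_2=\dots=N_U=1)\ \le\ \frac{c_2}{N^{(U-1)n_t}} $$ for all positive integers $N$.
   Context: All fields are subfields of $\mathbb{C}$, and $\mathcal{O}_E$ denotes the ring of integers of a number field $E$. Suitable data: $K$ is an imaginary quadratic extension of $\mathbb{Q}$ with class number $1$; $L/K$ is a cyclic Galois extension of degree $Un_t$ such that $L=K(\alpha)$ for some $\alpha\in\mathbb{R}$; $\sigma$ is a generator of $\mathrm{Gal}(L/K)$; $p\in\mathcal{O}_K$ is a prime that is inert in $L/K$ (i.e. $p\mathcal{O}_K$ is a nonzero prime ideal and $p\mathcal{O}_L$ is again prime). Put $\tau=\sigma^U$. For $x_1,\dots,x_{n_t}\in\mathcal{O}_L$ let $M(x_1,\dots,x_{n_t})$ be the $n_t\times n_t$ matrix whose $(i,j)$ entry is $\tau^{j-1}(x_{i-j+1})$ if $i\ge j$ and $p\,\tau^{j-1}(x_{i-j+1+n_t})$ if $i<j$. Automorphisms are applied to matrices entrywise. Let $k$ be an integer with $k>\frac{U(n_t-1)}{2}$. For $j=1,\dots,U$, the code $\mathcal{C}_j$ of the $j$th user is the set of $n_t\times Un_t$ matrices $$B_j=\left(M_j,\ \sigma(M_j),\ \dots,\ p^{-k}\sigma^{j-1}(M_j),\ \dots,\ \sigma^{U-1}(M_j)\right)$$ (the $l$th block is $\sigma^{l-1}(M_j)$,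 with the extra factor $p^{-k}$ exactly when $l=j$), where $M_j=M(x_{j,1},\dots,x_{j,n_t})$, $x_{j,h}\in\mathcal{O}_L$, and $x_{j,h}\ne0$ for some $h$. The code $C_{U,n_t}(L/K,p,\sigma,k)$ is the set of all $Un_t\times Un_t$ matrices obtained by stacking $B_1,\dots,B_U$ vertically with $B_j\in\mathcal{C}_j$. $\mathfrak{C}_{U,n_t}$ is the family of all codes $C_{U,n_t}(L/K,p,\sigma,k)$ obtained from any suitable $(K,L,p,\sigma)$ and any integer $k>\frac{U(n_t-1)}{2}$. Each $\mathbf{L}_j=\mathcal{C}_j\cup\{0\}$ is a lattice of rank $r=2Un_t^2$ in $M_{n_t\times Un_t}(\mathbb{C})$. Fix a $\mathbb{Z}$-basis $B_{j,1},\dots,B_{j,r}$ of each $\mathbf{L}_j$ (as part of the code; constants may depend on it), and for a positive integer $N_j$ let $\mathbf{L}_j(N_j)=\{\sum_{i=1}^r b_iB_{j,i}: b_i\in\mathbb{Z},\ -N_j\le b_i\le N_j\}$. The decay function of the code is $$D(N_1,\dots,N_U)=\min_{X_j\in\mathbf{L}_j(N_j)\setminus\{0\},\ j=1,\dots,U}\left|\det\left(X_1^T,X_2^T,\dots,X_U^T\right)^T\right|.$$ $D(N_1=N,N_2=\dots=N_U=1)$ means $D(N,1,\dots,1)$. *)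

theory Defs
  imports
    "HOL-Algebra.Algebraic_Closure_Type"
    "HOL-Algebra.Bij"
    "HOL-Algebra.Generated_Fields"
    "HOL-Algebra.Embedded_Algebras"
    "HOL-Algebra.QuotRing"
    "Jordan_Normal_Form.Determinant"
begin

section \<open>Number fields inside the complex numbers\<close>

abbreviation CC :: "complex ring"
  where "CC \<equiv> ring_of_type_algebra"

definition ring_of_integers :: "complex set \<Rightarrow> complex ring"
  where "ring_of_integers E = CC\<lparr>carrier := {x \<in> E. algebraic_int x}\<rparr>"

definition nonzero_ideals :: "('a, 'b) ring_scheme \<Rightarrow> 'a set set"
  where "nonzero_ideals R = {I. ideal I R \<and> I \<noteq> {\<zero>\<^bsub>R\<^esub>}}"

definition ideal_class_rel :: "('a, 'b) ring_scheme \<Rightarrow> ('a set \<times> 'a set) set"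
  where "ideal_class_rel R =
    {(I, J). I \<in> nonzero_ideals R \<and> J \<in> nonzero_ideals R \<and>
      (\<exists>a \<in> carrier R - {\<zero>\<^bsub>R\<^esub>}. \<exists>b \<in> carrier R - {\<zero>\<^bsub>R\<^esub>}.
        a <#\<^bsub>R\<^esub> I = b <#\<^bsub>R\<^esub> J)}"

text \<open>Every class of fractional ideals modulo principal ones contains a nonzero integral
  ideal, so it suffices to count classes of integral ideals.\<close>

definition class_number :: "complex set \<Rightarrow> nat"
  where "class_number E =
    card (nonzero_ideals (ring_of_integers E) // ideal_class_rel (ring_of_integers E))"

definition imaginary_quadratic :: "complex set \<Rightarrow> bool"
  where "imaginary_quadratic K \<longleftrightarrow>
    subfield K CC \<and> ring.dimension CC 2 \<rat> K \<and> \<not> K \<subseteq> \<real>"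

text \<open>Automorphisms are extensional, i.e. \<^const>\<open>undefined\<close> outside \<open>L\<close>.\<close>

definition galois_group :: "complex set \<Rightarrow> complex set \<Rightarrow> (complex \<Rightarrow> complex) monoid"
  where "galois_group L K = (BijGroup L)\<lparr>carrier :=
    {f \<in> Bij L. f \<in> ring_iso (CC\<lparr>carrier := L\<rparr>) (CC\<lparr>carrier := L\<rparr>) \<and> (\<forall>x\<in>K. f x = x)}\<rparr>"

definition galois_extension :: "nat \<Rightarrow> complex set \<Rightarrow> complex set \<Rightarrow> bool"
  where "galois_extension d L K \<longleftrightarrow>
    subfield K CC \<and> subfield L CC \<and> K \<subseteq> L \<and> ring.dimension CC d K L \<and>
    {x \<in> L. \<forall>f \<in> carrier (galois_group L K). f x = x} = K"

definition cyclic_galois_extension ::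
    "nat \<Rightarrow> complex set \<Rightarrow> complex set \<Rightarrow> (complex \<Rightarrow> complex) \<Rightarrow> bool"
  where "cyclic_galois_extension d L K \<sigma> \<longleftrightarrow>
    galois_extension d L K \<and>
    \<sigma> \<in> carrier (galois_group L K) \<and>
    generate (galois_group L K) {\<sigma>} = carrier (galois_group L K)"

definition inert_prime :: "complex set \<Rightarrow> complex set \<Rightarrow> complex \<Rightarrow> bool"
  where "inert_prime L K p \<longleftrightarrow>
    p \<in> carrier (ring_of_integers K) \<and> p \<noteq> 0 \<and>
    primeideal (PIdl\<^bsub>ring_of_integers K\<^esub> p) (ring_of_integers K) \<and>
    primeideal (PIdl\<^bsub>ring_of_integers L\<^esub> p) (ring_of_integers L)"

definition suitable ::
    "nat \<Rightarrow> nat \<Rightarrow> complex set \<Rightarrow> complex set \<Rightarrow> complex \<Rightarrow> (complex \<Rightarrow> complex) \<Rightarrow> bool"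
  where "suitable U nt K L p \<sigma> \<longleftrightarrow>
    imaginary_quadratic K \<and> class_number K = 1 \<and>
    cyclic_galois_extension (U * nt) L K \<sigma> \<and>
    (\<exists>\<alpha>::real. L = generate_field CC (insert (of_real \<alpha>) K)) \<and>
    inert_prime L K p"


section \<open>The codes\<close>

text \<open>Users, blocks, rows, columns and the \<open>x\<^sub>h\<close> are all numbered from 0.\<close>

definition user_matrix ::
    "nat \<Rightarrow> nat \<Rightarrow> complex \<Rightarrow> (complex \<Rightarrow> complex) \<Rightarrow> (nat \<Rightarrow> complex) \<Rightarrow> complex mat"
  where "user_matrix U nt p \<sigma> x =
    (let \<tau> = \<sigma> ^^ U in
      mat nt nt (\<lambda>(i, j). if j \<le> i then (\<tau> ^^ j) (x (i - j))
                          else p * (\<tau> ^^ j) (x (i + nt - j))))"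

definition user_block_row ::
    "nat \<Rightarrow> nat \<Rightarrow> complex \<Rightarrow> (complex \<Rightarrow> complex) \<Rightarrow> int \<Rightarrow> nat \<Rightarrow> complex mat \<Rightarrow> complex mat"
  where "user_block_row U nt p \<sigma> k j M =
    mat nt (U * nt) (\<lambda>(i, c). let l = c div nt in
      (if l = j then p powi (- k) else 1) * map_mat (\<sigma> ^^ l) M $$ (i, c mod nt))"

definition user_code ::
    "nat \<Rightarrow> nat \<Rightarrow> complex set \<Rightarrow> complex \<Rightarrow> (complex \<Rightarrow> complex) \<Rightarrow> int \<Rightarrow> nat \<Rightarrow> complex mat set"
  where "user_code U nt L p \<sigma> k j =
    {user_block_row U nt p \<sigma> k j (user_matrix U nt p \<sigma> x) | x.
      (\<forall>h<nt. x h \<in> carrier (ring_of_integers L)) \<and> (\<exists>h<nt. x h \<noteq> 0)}"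

definition stack :: "nat \<Rightarrow> nat \<Rightarrow> (nat \<Rightarrow> complex mat) \<Rightarrow> complex mat"
  where "stack U nt A = mat (U * nt) (U * nt) (\<lambda>(r, c). A (r div nt) $$ (r mod nt, c))"

definition stacked :: "nat \<Rightarrow> nat \<Rightarrow> (nat \<Rightarrow> complex mat set) \<Rightarrow> complex mat set"
  where "stacked U nt S = {stack U nt A | A. \<forall>j<U. A j \<in> S j}"

definition int_comb :: "nat \<Rightarrow> nat \<Rightarrow> nat \<Rightarrow> (nat \<Rightarrow> complex mat) \<Rightarrow> (nat \<Rightarrow> int) \<Rightarrow> complex mat"
  where "int_comb m n r B b = mat m n (\<lambda>(i, c). \<Sum>h<r. of_int (b h) * B h $$ (i, c))"

definition is_Z_basis ::
    "nat \<Rightarrow> nat \<Rightarrow> nat \<Rightarrow> complex mat set \<Rightarrow> (nat \<Rightarrow> complex mat) \<Rightarrow> bool"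
  where "is_Z_basis m n r \<Lambda> B \<longleftrightarrow>
    (\<forall>h<r. B h \<in> \<Lambda>) \<and> bij_betw (int_comb m n r B) ({..<r} \<rightarrow>\<^sub>E UNIV) \<Lambda>"

text \<open>The data from which a code is built, including the chosen lattice bases; the basis of the
  \<open>j\<close>-th lattice is \<open>lattice_basis C j 0, lattice_basis C j 1, \<dots>\<close>.\<close>

record mac_code =
  base_field :: "complex set"
  ext_field :: "complex set"
  inert_elt :: complex
  gal_gen :: "complex \<Rightarrow> complex"
  twist_exp :: int
  lattice_basis :: "nat \<Rightarrow> nat \<Rightarrow> complex mat"

definition code_of_user :: "nat \<Rightarrow> nat \<Rightarrow> mac_code \<Rightarrow> nat \<Rightarrow> complex mat set"
  where "code_of_user U nt C j =
    user_code U nt (ext_field C) (inert_elt C) (gal_gen C) (twist_exp C) j"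

definition codewords :: "nat \<Rightarrow> nat \<Rightarrow> mac_code \<Rightarrow> complex mat set"
  where "codewords U nt C = stacked U nt (code_of_user U nt C)"

definition user_lattice :: "nat \<Rightarrow> nat \<Rightarrow> mac_code \<Rightarrow> nat \<Rightarrow> complex mat set"
  where "user_lattice U nt C j = code_of_user U nt C j \<union> {0\<^sub>m nt (U * nt)}"

definition code_family :: "nat \<Rightarrow> nat \<Rightarrow> mac_code set"
  where "code_family U nt = {C.
    suitable U nt (base_field C) (ext_field C) (inert_elt C) (gal_gen C) \<and>
    real_of_int (twist_exp C) > real U * (real nt - 1) / 2 \<and>
    (\<forall>j<U. is_Z_basis nt (U * nt) (2 * U * nt\<^sup>2) (user_lattice U nt C j) (lattice_basis C j))}"

definition truncated_lattice :: "nat \<Rightarrow> nat \<Rightarrow> mac_code \<Rightarrow> nat \<Rightarrow> nat \<Rightarrow> complex mat set"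
  where "truncated_lattice U nt C j N =
    {int_comb nt (U * nt) (2 * U * nt\<^sup>2) (lattice_basis C j) b | b.
      \<forall>h < 2 * U * nt\<^sup>2. - int N \<le> b h \<and> b h \<le> int N}"

definition decay :: "nat \<Rightarrow> nat \<Rightarrow> mac_code \<Rightarrow> (nat \<Rightarrow> nat) \<Rightarrow> real"
  where "decay U nt C Ns = Min ((\<lambda>A. cmod (det A)) `
    stacked U nt (\<lambda>j. truncated_lattice U nt C j (Ns j) - {0\<^sub>m nt (U * nt)}))"

end

theory Submission
  imports Defs
begin

text \<open>Let \<open>A\<close> be a stacked codeword. Conjugating every block by the matrix of the element \<open>u\<close> with
  \<open>u\<^sup>n\<^sup>t = p\<close> of the cyclic algebra shows that \<open>det A\<close> is fixed by \<open>\<sigma>\<^sup>U\<close>, so the product of its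
  conjugates under \<open>\<sigma>\<^sup>0, \<dots>, \<sigma>\<^bsup>U - 1\<^esup>\<close> lies in \<open>K\<close>; scaled by a power of \<open>p\<close> it is an integer of the
  imaginary quadratic field \<open>K\<close>, and it is nonzero because exactly one Leibniz term has minimal
  \<open>p\<close>-adic valuation. Hence it has absolute value at least 1, while each conjugate is
  \<open>O(N\<^sup>n\<^sup>t)\<close>; this is the lower bound. For the upper bound, fix the codewords of all users but
  the first. Up to a constant the determinant is then the determinant of an \<open>nt \<times> nt\<close> matrix of
  linear forms in the \<open>2 U nt\<^sup>2\<close> coordinates of the first user, and by the pigeonhole principle
  all \<open>2 nt\<^sup>2\<close> real forms can be made \<open>O(N\<^bsup>1 - U\<^esup>)\<close> at once.\<close>

section \<open>Determinants and linear forms\<close>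

text \<open>The element \<open>u\<close> behaves like a root of \<open>p\<close> of valuation 1/nt.
  Weighting a block entry in row i and column l by nt times its valuation plus i - l therefore gives
  the coefficient x_d the weight nt * v(x_d) + d, and since d < nt the least weight determines d. A
  factor p^k off the diagonal blocks weighs at least nt, so no Leibniz term that leaves these blocks
  can compete. Invariance under the U-th power of \<sigma> is what makes the exponent sharp: U
  conjugates suffice instead of U * nt, and all but the determinant itself are divided out, each
  costing N^nt. On the other side 2 U nt^2 integer coordinates face 2 nt^2 real forms; this ratio U
  allows a range of length O(N) to be cut into N^U cells, of length O(N^(1-U)). That \<sigma> has
  order dividing the degree is not part of the definition of a cyclic extension used here; it is
  obtained by comparing the orbit of the generator \<alpha> with the dimension of L over K.\<close>

lemma permutes_less: "q permutes {0..<n} \<Longrightarrow> q i < n \<longleftrightarrow> i < (n::nat)"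
  using permutes_in_image[of q "{0..<n}" i] by simp

text \<open>The matrix is \<open>f\<close> conjugated by the permutation matrix of \<open>s\<close>
  and then scaled by two diagonal matrices: the sign of \<open>s\<close> enters twice and cancels.
  The case \<open>s = id\<close> serves as plain row scaling.\<close>

lemma det_conjugate_permutation:
  fixes f :: "nat \<Rightarrow> nat \<Rightarrow> 'a::comm_ring_1"
  assumes s: "s permutes {0..<n}"
  shows "det (mat n n (\<lambda>(i, j). a i * f (s i) (s j) * b j)) =
    (\<Prod>i<n. a i * b i) * det (mat n n (\<lambda>(i, j). f i j))"
proof -
  have s_less: "s i < n \<longleftrightarrow> i < n" for i
    using permutes_in_image[OF s, of i] by simp
  have "det (mat n n (\<lambda>(i, j). a i * f (s i) (s j) * b j)) =
      (\<Sum>q | q permutes {0..<n}. signof q * (\<Prod>i = 0..<n. a i * f (s i) (s (q i)) * b (q i)))"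
    by (subst det_def'[of _ n])
       (auto intro!: sum.cong prod.cong arg_cong2[of _ _ _ _ "(*)"] simp: permutes_less)
  also have "\<dots> = (\<Sum>q | q permutes {0..<n}.
      (\<Prod>i<n. a i * b i) * (signof q * (\<Prod>i = 0..<n. f (s i) (s (q i)))))"
  proof (rule sum.cong)
    fix q assume "q \<in> {q. q permutes {0..<n}}"
    then have "(\<Prod>i = 0..<n. b (q i)) = (\<Prod>i = 0..<n. b i)"
      using prod.permute[of q "{0..<n}" b] by (simp add: comp_def)
    then show "signof q * (\<Prod>i = 0..<n. a i * f (s i) (s (q i)) * b (q i)) =
        (\<Prod>i<n. a i * b i) * (signof q * (\<Prod>i = 0..<n. f (s i) (s (q i))))"
      by (simp add: prod.distrib lessThan_atLeast0 mult_ac)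
  qed simp
  also have "\<dots> = (\<Prod>i<n. a i * b i) * det (mat n n (\<lambda>(i, j). f (s i) (s j)))"
    by (subst det_def'[of _ n])
       (auto intro!: sum.cong prod.cong arg_cong2[of _ _ _ _ "(*)"] simp: permutes_less sum_distrib_left)
  also have "det (mat n n (\<lambda>(i, j). f (s i) (s j))) = signof s * det (mat n n (\<lambda>(i, j). f i (s j)))"
    by (subst det_permute_rows[OF _ s, of "mat n n (\<lambda>(i, j). f i (s j))", symmetric])
       (auto intro!: arg_cong[of _ _ det] simp: s_less)
  \<comment> \<open>Transposing turns the permuted columns into permuted rows, so the same rule
    yields the second sign.\<close>
  also have "det (mat n n (\<lambda>(i, j). f i (s j))) = det (mat n n (\<lambda>(i, j). f j (s i)))"
    by (subst det_transpose[symmetric, of _ n]) (auto intro!: arg_cong[of _ _ det])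
  also have "\<dots> = signof s * det (mat n n (\<lambda>(i, j). f j i))"
    by (subst det_permute_rows[OF _ s, of "mat n n (\<lambda>(i, j). f j i)", symmetric])
       (auto intro!: arg_cong[of _ _ det] simp: s_less)
  also have "det (mat n n (\<lambda>(i, j). f j i)) = det (mat n n (\<lambda>(i, j). f i j))"
    by (subst det_transpose[symmetric, of _ n]) (auto intro!: arg_cong[of _ _ det])
  also have "signof s * (signof s * det (mat n n (\<lambda>(i, j). f i j))) = det (mat n n (\<lambda>(i, j). f i j))"
    by (simp add: sign_def)
  finally show ?thesis .
qed

section \<open>Determinant estimates from the Leibniz formula\<close>

lemma norm_det_le:
  fixes A :: "complex mat"
  assumes A: "A \<in> carrier_mat n n"
    and bound: "\<And>q. q permutes {0..<n} \<Longrightarrow> (\<Prod>i = 0..<n. cmod (A $$ (i, q i))) \<le> B"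
  shows "cmod (det A) \<le> fact n * B"
proof -
  have "cmod (det A) \<le> (\<Sum>q | q permutes {0..<n}. cmod (signof q * (\<Prod>i = 0..<n. A $$ (i, q i))))"
    unfolding det_def'[OF A] by (rule norm_sum)
  also have "\<dots> \<le> (\<Sum>q | q permutes {0..<n}. B)"
  proof (rule sum_mono)
    fix q assume "q \<in> {q. q permutes {0..<n}}"
    moreover have "cmod (signof q) = 1"
      by (simp add: sign_def)
    ultimately show "cmod (signof q * (\<Prod>i = 0..<n. A $$ (i, q i))) \<le> B"
      using bound by (simp add: norm_mult prod_norm)
  qed
  also have "\<dots> = fact n * B"
    by (simp add: card_permutations[of "{0..<n}" n])
  finally show ?thesis .
qed

lemma norm_det_le_rows:
  assumes A: "A \<in> carrier_mat n n"
    and bound: "\<And>i j. i < n \<Longrightarrow> j < n \<Longrightarrow> cmod (A $$ (i, j)) \<le> R i"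
  shows "cmod (det A) \<le> fact n * (\<Prod>i = 0..<n. R i)"
proof (rule norm_det_le[OF A])
  fix q assume "q permutes {0..<n}"
  then show "(\<Prod>i = 0..<n. cmod (A $$ (i, q i))) \<le> (\<Prod>i = 0..<n. R i)"
    by (intro prod_mono) (auto intro!: bound simp: permutes_less)
qed

text \<open>A Leibniz term survives only if \<open>q\<close> fixes every index from \<open>m\<close>
  on; by injectivity it then maps the first \<open>m\<close> indices to themselves, so it meets only
  corner entries. The first \<open>m\<close> rows may be arbitrary to the right of the
  corner.\<close>

lemma norm_det_le_corner:
  assumes A: "A \<in> carrier_mat n n" and "m \<le> n"
    and corner: "\<And>i j. i < m \<Longrightarrow> j < m \<Longrightarrow> cmod (A $$ (i, j)) \<le> \<epsilon>"
    and unit_rows: "\<And>i j. m \<le> i \<Longrightarrow> i < n \<Longrightarrow> j < n \<Longrightarrow> A $$ (i, j) = of_bool (i = j)"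
    and "0 \<le> \<epsilon>"
  shows "cmod (det A) \<le> fact n * \<epsilon> ^ m"
proof (rule norm_det_le[OF A])
  fix q assume q: "q permutes {0..<n}"
  show "(\<Prod>i = 0..<n. cmod (A $$ (i, q i))) \<le> \<epsilon> ^ m"
  proof (cases "\<exists>i. m \<le> i \<and> i < n \<and> q i \<noteq> i")
    case True
    then obtain i where "m \<le> i" "i < n" "q i \<noteq> i" by blast
    then have "A $$ (i, q i) = 0"
      using unit_rows q by (simp add: permutes_less)
    then have "(\<Prod>i = 0..<n. cmod (A $$ (i, q i))) = 0"
      using \<open>i < n\<close> by (intro prod_zero) auto
    with \<open>0 \<le> \<epsilon>\<close> show ?thesis by (simp only: zero_le_power)
  next
    case False
    have q_less: "q i < m" if "i < m" for i
    proof (rule ccontr)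
      assume "\<not> q i < m"
      then have "q (q i) = q i"
        using False \<open>m \<le> n\<close> that q by (auto simp: permutes_less)
      then have "q i = i"
        using permutes_inj[OF q] by (auto dest: injD)
      with \<open>\<not> q i < m\<close> that show False by simp
    qed
    have "(\<Prod>i = 0..<n. cmod (A $$ (i, q i))) =
        (\<Prod>i = 0..<m. cmod (A $$ (i, q i))) * (\<Prod>i = m..<n. cmod (A $$ (i, q i)))"
      by (rule prod.atLeastLessThan_concat[symmetric]) (use \<open>m \<le> n\<close> in auto)
    also have "(\<Prod>i = m..<n. cmod (A $$ (i, q i))) = 1"
      using False by (intro prod.neutral) (auto simp: unit_rows)
    also have "(\<Prod>i = 0..<m. cmod (A $$ (i, q i))) \<le> (\<Prod>i = 0..<m. \<epsilon>)"
      by (intro prod_mono) (auto intro: corner q_less)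
    finally show ?thesis by simp
  qed
qed

section \<open>Simultaneously small linear forms by pigeonhole\<close>

lemma abs_floor_divide_eq_imp_less:
  fixes x y \<delta> :: real
  assumes "\<lfloor>x / \<delta>\<rfloor> = \<lfloor>y / \<delta>\<rfloor>" "0 < \<delta>"
  shows "\<bar>x - y\<bar> < \<delta>"
proof -
  have "\<bar>x / \<delta> - y / \<delta>\<bar> < 1"
    using assms(1) by linarith
  then show ?thesis
    using \<open>0 < \<delta>\<close> by (simp add: diff_divide_distrib[symmetric] abs_divide)
qed

text \<open>Dirichlet's argument for coefficient vectors with entries in \<open>{0..int N}\<close>.
  Each of the \<open>2 * card I\<close> real coordinates falls into one of \<open>N ^ U\<close>
  cells, which makes \<open>N ^ r\<close> classes for \<open>(N + 1) ^ r\<close> vectors; two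
  vectors of one class are subtracted.\<close>

lemma small_values_of_linear_forms:
  fixes g :: "'i \<Rightarrow> nat \<Rightarrow> complex"
  assumes I: "finite I" "I \<noteq> {}" and "0 < U" and r: "r = 2 * U * card I"
  shows "\<exists>C>0. \<forall>N>0. \<exists>b :: nat \<Rightarrow> int. (\<forall>h<r. \<bar>b h\<bar> \<le> int N) \<and> (\<exists>h<r. b h \<noteq> 0) \<and>
    (\<forall>i\<in>I. cmod (\<Sum>h<r. of_int (b h) * g i h) \<le> C / real N ^ (U - 1))"
proof -
  \<comment> \<open>The summand 1 makes \<open>R\<close> positive and the estimate
    \<open>S_less\<close> strict, which keeps the cell index below \<open>N ^ U\<close>.\<close>
  define R where "R = 1 + (\<Sum>i\<in>I. \<Sum>h<r. cmod (g i h))"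
  have "0 < R"
    unfolding R_def by (intro add_pos_nonneg sum_nonneg) auto
  have small: "\<exists>b :: nat \<Rightarrow> int. (\<forall>h<r. \<bar>b h\<bar> \<le> int N) \<and> (\<exists>h<r. b h \<noteq> 0) \<and>
    (\<forall>i\<in>I. cmod (\<Sum>h<r. of_int (b h) * g i h) \<le> 4 * R / real N ^ (U - 1))" if "0 < N" for N
  proof -
    \<comment> \<open>The real and imaginary parts of all values lie between \<open>- R * N\<close>
      and \<open>R * N\<close>; this interval is cut into \<open>N ^ U\<close> pieces of length
      \<delta>.\<close>
    define \<delta> where "\<delta> = 2 * R * real N / real N ^ U"
    have "0 < \<delta>"
      using \<open>0 < R\<close> that by (simp add: \<delta>_def)
    have \<delta>: "2 * \<delta> = 4 * R / real N ^ (U - 1)"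
      using that \<open>0 < U\<close> by (cases U) (simp_all add: \<delta>_def field_simps)
    define S where "S i b = (\<Sum>h<r. complex_of_int (b h) * g i h)" for i b
    define cell where "cell t = \<lfloor>(t + R * real N) / \<delta>\<rfloor>" for t :: real
    define F where "F = {..<r} \<rightarrow>\<^sub>E {0..int N}"
    define code where "code b = (\<lambda>i\<in>I. (cell (Re (S i b)), cell (Im (S i b))))" for b
    have S_less: "cmod (S i b) < R * real N" if "b \<in> F" "i \<in> I" for b i
    proof -
      have "cmod (S i b) \<le> (\<Sum>h<r. cmod (complex_of_int (b h) * g i h))"
        unfolding S_def by (rule norm_sum)
      also have "\<dots> \<le> (\<Sum>h<r. real N * cmod (g i h))"
      proof (rule sum_mono)
        fix h assume "h \<in> {..<r}"
        then have "b h \<in> {0..int N}"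
          using \<open>b \<in> F\<close> PiE_mem unfolding F_def by fast
        then have "\<bar>real_of_int (b h)\<bar> \<le> real N" by simp
        then show "cmod (complex_of_int (b h) * g i h) \<le> real N * cmod (g i h)"
          unfolding norm_mult norm_of_int by (rule mult_right_mono) simp
      qed
      also have "\<dots> = real N * (\<Sum>h<r. cmod (g i h))"
        by (simp add: sum_distrib_left)
      also have "(\<Sum>h<r. cmod (g i h)) \<le> (\<Sum>i\<in>I. \<Sum>h<r. cmod (g i h))"
        using I \<open>i \<in> I\<close> by (intro member_le_sum) (auto intro: sum_nonneg)
      finally show ?thesis
        using \<open>0 < N\<close> by (simp add: R_def algebra_simps)
    qed
    have cell_range: "cell t \<in> {0..<int N ^ U}" if "\<bar>t\<bar> < R * real N" for t
    proof -
      have "0 \<le> (t + R * real N) / \<delta>"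
        using that \<open>0 < \<delta>\<close> by (intro divide_nonneg_pos) auto
      moreover have "(t + R * real N) / \<delta> < (2 * R * real N) / \<delta>"
        using that \<open>0 < \<delta>\<close> by (intro divide_strict_right_mono) auto
      moreover have "(2 * R * real N) / \<delta> = of_int (int N ^ U)"
        using \<open>0 < R\<close> \<open>0 < N\<close> by (simp add: \<delta>_def)
      ultimately show ?thesis
        by (simp add: cell_def floor_less_iff)
    qed
    let ?T = "I \<rightarrow>\<^sub>E {0..<int N ^ U} \<times> {0..<int N ^ U}"
    have "code ` F \<subseteq> ?T"
    proof (intro image_subsetI PiE_I)
      fix b i assume "b \<in> F" "i \<in> I"
      then have "\<bar>Re (S i b)\<bar> < R * real N" "\<bar>Im (S i b)\<bar> < R * real N"
        using S_less[of b i] abs_Re_le_cmod[of "S i b"] abs_Im_le_cmod[of "S i b"] by linarith+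
      then show "code b i \<in> {0..<int N ^ U} \<times> {0..<int N ^ U}"
        using cell_range \<open>i \<in> I\<close> by (simp add: code_def)
    qed (simp add: code_def)
    then have "card (code ` F) \<le> card ?T"
      using I by (intro card_mono) (auto intro: finite_PiE)
    also have "card ?T = (N ^ U * N ^ U) ^ card I"
      by (simp add: card_PiE I card_cartesian_product nat_power_eq)
    also have "\<dots> = N ^ r"
      unfolding r by (metis mult_2 power_add power_mult)
    also have "N ^ r < (N + 1) ^ r"
      using I \<open>0 < U\<close> by (intro power_strict_mono) (auto simp: r card_gt_0_iff)
    also have "(N + 1) ^ r = card F"
      by (simp add: F_def card_PiE nat_add_distrib)
    finally have "\<not> inj_on code F"
      by (rule pigeonhole)
    then obtain b1 b2 where b: "b1 \<in> F" "b2 \<in> F" "b1 \<noteq> b2" "code b1 = code b2"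
      by (auto simp: inj_on_def)
    have "\<forall>h<r. \<bar>b1 h - b2 h\<bar> \<le> int N"
    proof (intro allI impI)
      fix h assume "h < r"
      then have "b1 h \<in> {0..int N}" "b2 h \<in> {0..int N}"
        using b PiE_mem unfolding F_def by (metis lessThan_iff)+
      then show "\<bar>b1 h - b2 h\<bar> \<le> int N" by auto
    qed
    moreover have "\<exists>h<r. b1 h - b2 h \<noteq> 0"
      using PiE_ext[of b1 "{..<r}" _ b2] b unfolding F_def by force
    moreover have "cmod (\<Sum>h<r. of_int (b1 h - b2 h) * g i h) \<le> 4 * R / real N ^ (U - 1)" if "i \<in> I" for i
    proof -
      have *: "(\<Sum>h<r. of_int (b1 h - b2 h) * g i h) = S i b1 - S i b2"
        by (simp add: S_def sum_subtractf algebra_simps)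
      have "code b1 i = code b2 i" using b(4) by simp
      then have "\<bar>Re (S i b1) - Re (S i b2)\<bar> < \<delta>" "\<bar>Im (S i b1) - Im (S i b2)\<bar> < \<delta>"
        using abs_floor_divide_eq_imp_less[OF _ \<open>0 < \<delta>\<close>, of "Re (S i b1) + R * real N" "Re (S i b2) + R * real N"]
          abs_floor_divide_eq_imp_less[OF _ \<open>0 < \<delta>\<close>, of "Im (S i b1) + R * real N" "Im (S i b2) + R * real N"]
          \<open>i \<in> I\<close>
        by (simp_all add: code_def cell_def)
      then have "cmod (S i b1 - S i b2) \<le> 2 * \<delta>"
        using cmod_le[of "S i b1 - S i b2"] by simp
      then show ?thesis unfolding * \<delta> .
    qed
    ultimately show ?thesis
      by (intro exI[of _ "\<lambda>h. b1 h - b2 h"]) blast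
  qed
  show ?thesis
    using \<open>0 < R\<close> small by (intro exI[of _ "4 * R"]) simp
qed

section \<open>Subfields of the complex numbers\<close>

lemma CC_ops [simp]:
  "carrier CC = UNIV" "x \<otimes>\<^bsub>CC\<^esub> y = x * y" "x \<oplus>\<^bsub>CC\<^esub> y = x + y" "\<one>\<^bsub>CC\<^esub> = 1" "\<zero>\<^bsub>CC\<^esub> = 0"
  by (simp_all add: ring_of_type_algebra_def)

interpretation CC: cring CC
  by (rule cring_from_type_algebra)

lemma CC_a_inv [simp]: "\<ominus>\<^bsub>CC\<^esub> x = - x"
  by (rule CC.minus_equality) simp_all

lemma CC_m_inv: "x \<noteq> 0 \<Longrightarrow> inv\<^bsub>CC\<^esub> x = inverse x"
  by (rule CC.comm_inv_char) simp_all

locale complex_subfield =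
  fixes F :: "complex set"
  assumes subfield: "subfield F CC"
begin

lemma zero_mem [simp, intro]: "0 \<in> F" and one_mem [simp, intro]: "1 \<in> F"
  and add_mem [simp, intro]: "x \<in> F \<Longrightarrow> y \<in> F \<Longrightarrow> x + y \<in> F"
  and mult_mem [simp, intro]: "x \<in> F \<Longrightarrow> y \<in> F \<Longrightarrow> x * y \<in> F"
  and uminus_mem [simp, intro]: "x \<in> F \<Longrightarrow> - x \<in> F"
  using subringE(2,3,5,6,7)[OF subfieldE(1)[OF subfield]] by simp_all

lemma inverse_mem [simp, intro]: "x \<in> F \<Longrightarrow> inverse x \<in> F"
  using CC.subfield_m_inv(1)[OF subfield, of x] by (cases "x = 0") (auto simp: CC_m_inv)

lemma diff_mem [simp, intro]: "x \<in> F \<Longrightarrow> y \<in> F \<Longrightarrow> x - y \<in> F"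
  using add_mem[of x "- y"] by simp

lemma divide_mem [simp, intro]: "x \<in> F \<Longrightarrow> y \<in> F \<Longrightarrow> x / y \<in> F"
  by (simp add: divide_inverse)

lemma power_mem [simp, intro]: "x \<in> F \<Longrightarrow> x ^ m \<in> F"
  by (induction m) auto

lemma sum_mem [intro]: "(\<And>i. i \<in> I \<Longrightarrow> f i \<in> F) \<Longrightarrow> sum f I \<in> F"
  by (induction I rule: infinite_finite_induct) auto

lemma prod_mem [intro]: "(\<And>i. i \<in> I \<Longrightarrow> f i \<in> F) \<Longrightarrow> prod f I \<in> F"
  by (induction I rule: infinite_finite_induct) auto

lemma of_nat_mem [simp]: "of_nat m \<in> F"
  by (induction m) auto

lemma of_int_mem [simp]: "of_int m \<in> F"
  by (cases m) auto

lemma combine_eq_sum: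
  assumes "length ks = length us"
  shows "CC.combine ks us = (\<Sum>i<length us. ks ! i * us ! i)"
  using assms by (induction ks us rule: list_induct2) (simp_all add: sum.lessThan_Suc_shift del: sum.lessThan_Suc)

lemma linear_dependence:
  assumes dim: "CC.dimension n F E" and f: "\<And>i. i \<le> n \<Longrightarrow> f i \<in> E"
  shows "\<exists>c. (\<forall>i\<le>n. c i \<in> F) \<and> (\<exists>i\<le>n. c i \<noteq> 0) \<and> (\<Sum>i\<le>n. c i * f i) = 0"
proof -
  let ?us = "map f [0..<Suc n]"
  have "\<not> CC.independent F ?us"
    using CC.independent_length_le_dimension[OF subfield dim, of ?us] f
    by (auto simp: less_Suc_eq_le image_subset_iff simp del: upt_Suc)
  then obtain ks where ks: "length ks = length ?us" "CC.combine ks ?us = \<zero>\<^bsub>CC\<^esub>"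
      "set ks \<subseteq> F" "set ks \<noteq> {\<zero>\<^bsub>CC\<^esub>}"
    by (rule CC.dependent_imp_non_trivial_combine[OF subfield, rotated]) auto
  have "(\<Sum>i\<le>n. ks ! i * f i) = 0"
  proof -
    have "(\<Sum>i<Suc n. ks ! i * ?us ! i) = 0"
      using ks(2) combine_eq_sum[OF ks(1)] by (simp del: upt_Suc sum.lessThan_Suc)
    also have "(\<Sum>i<Suc n. ks ! i * ?us ! i) = (\<Sum>i<Suc n. ks ! i * f i)"
      by (intro sum.cong) (auto simp del: upt_Suc)
    finally show ?thesis
      by (simp only: lessThan_Suc_atMost)
  qed
  moreover have "\<forall>i\<le>n. ks ! i \<in> F"
    using ks(1,3) by (auto simp: less_Suc_eq_le intro!: subsetD[OF ks(3)] nth_mem)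
  moreover have "\<exists>i\<le>n. ks ! i \<noteq> 0"
  proof (rule ccontr)
    assume "\<not> ?thesis"
    then have "set ks \<subseteq> {0}"
      using ks(1) by (force simp: in_set_conv_nth less_Suc_eq_le)
    \<comment> \<open>Nontriviality is available as \<open>set ks \<noteq> {0}\<close>, which an
      empty list would satisfy too; the length \<open>n + 1\<close> excludes that.\<close>
    moreover have "ks \<noteq> []" using ks(1) by auto
    ultimately have "set ks = {0}" by (cases ks) auto
    then show False using ks(4) by simp
  qed
  ultimately show ?thesis by blast
qed

text \<open>Every vector in the span of the later ones is dropped. This prepares the comparison of a
  basis with an arbitrary spanning list, because the length bound used for it compares two
  independent lists.\<close>

lemma short_base:
  "\<exists>vs. CC.independent F vs \<and> CC.Span F vs = CC.Span F us \<and> length vs \<le> length us"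
proof (induction us)
  case (Cons u us)
  then obtain vs where vs: "CC.independent F vs" "CC.Span F vs = CC.Span F us" "length vs \<le> length us"
    by blast
  show ?case
  proof (cases "u \<in> CC.Span F us")
    case True
    have "CC.Span F (u # us) \<subseteq> CC.Span F us"
      using True CC.Span_base_incl[OF subfield, of us]
      by (intro CC.mono_Span_subset[OF subfield]) auto
    moreover have "CC.Span F us \<subseteq> CC.Span F (u # us)"
      by (rule CC.mono_Span[OF subfield]) auto
    ultimately show ?thesis using vs by (intro exI[of _ vs]) auto
  next
    case False
    then have "CC.independent F (u # vs)"
      using vs by (intro CC.li_Cons) (auto simp del: CC.Span.simps)
    moreover have "CC.Span F (u # vs) = CC.Span F (u # us)"
      using vs(2) by simp
    ultimately show ?thesis using vs(3) by (intro exI[of _ "u # vs"]) auto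
  qed
qed auto

lemma dimension_le_spanning:
  assumes dim: "CC.dimension n F E"
    and span: "\<And>x. x \<in> E \<Longrightarrow> \<exists>c. (\<forall>i<m. c i \<in> F) \<and> x = (\<Sum>i<m. c i * f i)"
  shows "n \<le> m"
proof -
  let ?us = "map f [0..<m]"
  have "E \<subseteq> CC.Span F ?us"
  proof
    fix x assume "x \<in> E"
    then obtain c where c: "\<forall>i<m. c i \<in> F" "x = (\<Sum>i<m. c i * f i)" using span by blast
    have "x = CC.combine (map c [0..<m]) ?us"
      by (subst combine_eq_sum) (simp_all add: c)
    moreover have "set (map c [0..<m]) \<subseteq> F" using c by auto
    ultimately show "x \<in> CC.Span F ?us"
      by (subst CC.Span_mem_iff_length_version[OF subfield]) (auto intro!: exI[of _ "map c [0..<m]"])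
  qed
  obtain vs where vs: "CC.independent F vs" "length vs = n" "CC.Span F vs = E"
    using CC.exists_base[OF subfield dim] by blast
  obtain ws where ws: "CC.independent F ws" "CC.Span F ws = CC.Span F ?us" "length ws \<le> length ?us"
    using short_base by blast
  have "set vs \<subseteq> E"
    using CC.Span_base_incl[OF subfield, of vs] vs by simp
  then have "n \<le> length ws"
    using CC.independent_length_le[OF subfield vs(1) ws(1)] vs(2) ws(2) \<open>E \<subseteq> _\<close> by auto
  with ws(3) show ?thesis by simp
qed

end

text \<open>All laws are relative to \<open>L\<close>, since the elements of
  \<open>galois_group\<close> are \<open>undefined\<close> outside it. The powers of \<sigma> are
  further instances.\<close>

locale subfield_endo = complex_subfield L for L +
  fixes f :: "complex \<Rightarrow> complex"
  assumes closed [simp, intro]: "x \<in> L \<Longrightarrow> f x \<in> L"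
    and add: "x \<in> L \<Longrightarrow> y \<in> L \<Longrightarrow> f (x + y) = f x + f y"
    and mult: "x \<in> L \<Longrightarrow> y \<in> L \<Longrightarrow> f (x * y) = f x * f y"
    and one [simp]: "f 1 = 1"
begin

lemma zero [simp]: "f 0 = 0"
  using add[of 0 0] by simp

lemma uminus: "x \<in> L \<Longrightarrow> f (- x) = - f x"
  using add[of x "- x"] by (simp add: eq_neg_iff_add_eq_0 add.commute)

lemma sum: "(\<And>i. i \<in> I \<Longrightarrow> g i \<in> L) \<Longrightarrow> f (sum g I) = (\<Sum>i\<in>I. f (g i))"
  by (induction I rule: infinite_finite_induct) (simp_all add: add sum_mem)

lemma prod: "(\<And>i. i \<in> I \<Longrightarrow> g i \<in> L) \<Longrightarrow> f (prod g I) = (\<Prod>i\<in>I. f (g i))"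
  by (induction I rule: infinite_finite_induct) (simp_all add: mult prod_mem)

lemma power: "x \<in> L \<Longrightarrow> f (x ^ m) = f x ^ m"
  by (induction m) (auto simp: mult)

lemma of_nat [simp]: "f (of_nat m) = of_nat m"
  by (induction m) (auto simp: add)

lemma of_int [simp]: "f (of_int m) = of_int m"
  by (cases m) (auto simp: uminus simp del: of_nat_Suc)

lemma det:
  assumes "A \<in> carrier_mat n n" and "\<And>i j. i < n \<Longrightarrow> j < n \<Longrightarrow> A $$ (i, j) \<in> L"
  shows "f (det A) = det (map_mat f A)" and "det A \<in> L"
proof -
  have sgn: "signof q \<in> L" "f (signof q) = signof q" for q :: "nat \<Rightarrow> nat"
    by (auto simp: sign_def uminus)
  have mem: "A $$ (i, q i) \<in> L" if "q permutes {0..<n}" "i < n" for q i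
    using assms(2) that by (simp add: permutes_less)
  show "f (det A) = det (map_mat f A)"
  proof -
    have "f (det A) = (\<Sum>q | q permutes {0..<n}. f (signof q * (\<Prod>i = 0..<n. A $$ (i, q i))))"
      unfolding det_def'[OF assms(1)] by (intro sum mult_mem prod_mem) (auto simp: sgn mem)
    also have "\<dots> = (\<Sum>q | q permutes {0..<n}. signof q * (\<Prod>i = 0..<n. map_mat f A $$ (i, q i)))"
    proof (rule sum.cong)
      fix q assume "q \<in> {q. q permutes {0..<n}}"
      then have q: "q permutes {0..<n}" by simp
      have "f (signof q * (\<Prod>i = 0..<n. A $$ (i, q i))) = signof q * (\<Prod>i = 0..<n. f (A $$ (i, q i)))"
        using q by (subst mult) (auto simp: sgn mem intro!: prod_mem prod arg_cong2[of _ _ _ _ "(*)"])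
      also have "\<dots> = signof q * (\<Prod>i = 0..<n. map_mat f A $$ (i, q i))"
        using q assms(1) by (auto simp: permutes_less intro!: arg_cong2[of _ _ _ _ "(*)"] prod.cong)
      finally show "f (signof q * (\<Prod>i = 0..<n. A $$ (i, q i))) =
          signof q * (\<Prod>i = 0..<n. map_mat f A $$ (i, q i))" .
    qed simp
    also have "\<dots> = det (map_mat f A)"
      using assms(1) by (subst det_def'[of _ n]) auto
    finally show ?thesis .
  qed
  show "det A \<in> L"
    by (subst det_def'[OF assms(1)]) (auto intro!: sum_mem mult_mem prod_mem simp: sgn mem)
qed

lemma algebraic_int_image:
  assumes "algebraic_int x" "x \<in> L"
  shows "algebraic_int (f x)"
proof -
  obtain q where q: "Polynomial.lead_coeff q = 1" "\<forall>i. Polynomial.coeff q i \<in> \<int>" "poly q x = 0"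
    using assms(1) by (auto elim: algebraic_int.cases)
  have c: "Polynomial.coeff q i \<in> L" "f (Polynomial.coeff q i) = Polynomial.coeff q i" for i
    using q(2) by (auto elim!: Ints_cases dest: spec[of _ i])
  have "poly q (f x) = f (poly q x)"
    using assms(2) by (simp add: poly_altdef sum mult power c)
  then have "poly q (f x) = 0" using q(3) by simp
  with q show ?thesis by (intro algebraic_int.intros)
qed

lemma funpow_endo: "subfield_endo L (f ^^ m)"
proof (induction m)
  case 0 then show ?case by unfold_locales (auto simp: subfield)
next
  case (Suc m)
  then interpret fm: subfield_endo L "f ^^ m" .
  show ?case by unfold_locales (auto simp: add mult fm.add fm.mult)
qed

lemma map_poly_mult:
  assumes "\<And>i. Polynomial.coeff a i \<in> L" "\<And>i. Polynomial.coeff b i \<in> L"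
  shows "map_poly f (a * b) = map_poly f a * map_poly f b"
  by (rule poly_eqI) (auto simp: coeff_map_poly coeff_mult sum mult assms)

text \<open>Membership of the coefficients in \<open>L\<close> is proved along with the equation
  because the induction step needs it to apply \<open>map_poly_mult\<close>.\<close>

lemma map_poly_linear_prod:
  assumes "\<And>i. i \<in> I \<Longrightarrow> g i \<in> L"
  shows "map_poly f (\<Prod>i\<in>I. [:- g i, 1:]) = (\<Prod>i\<in>I. [:- f (g i), 1:])
    \<and> (\<forall>k. Polynomial.coeff (\<Prod>i\<in>I. [:- g i, 1:]) k \<in> L)"
  using assms
proof (induction I rule: infinite_finite_induct)
  case (insert i I)
  have c: "Polynomial.coeff [:- g i, 1:] k \<in> L" for k
    using insert.prems[of i] by (auto simp: coeff_pCons split: nat.split)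
  have IH: "map_poly f (\<Prod>i\<in>I. [:- g i, 1:]) = (\<Prod>i\<in>I. [:- f (g i), 1:])"
      "\<And>k. Polynomial.coeff (\<Prod>i\<in>I. [:- g i, 1:]) k \<in> L"
    using insert by auto
  have "map_poly f [:- g i, 1:] = [:- f (g i), 1:]"
    using insert.prems[of i] by (simp add: map_poly_pCons uminus)
  moreover have "Polynomial.coeff ([:- g i, 1:] * (\<Prod>i\<in>I. [:- g i, 1:])) k \<in> L" for k
    unfolding coeff_mult by (intro sum_mem mult_mem IH c)
  ultimately show ?case
    using insert.hyps map_poly_mult[OF c IH(2)] IH(1) by (simp del: mult_pCons_left)
qed (auto simp: coeff_pCons split: nat.split)

end

section \<open>Cyclic extensions\<close>

lemma (in subfield_endo) inverse:
  assumes "x \<in> L" shows "f (inverse x) = inverse (f x)"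
proof (cases "x = 0")
  case False
  then have "f x * f (inverse x) = 1"
    using mult[of x "inverse x"] assms by simp
  then show ?thesis by (simp add: inverse_unique)
qed simp

text \<open>What is kept of a cyclic Galois extension: an automorphism of \<open>L\<close> whose
  fixed field is exactly \<open>K\<close>. The order of \<sigma> is derived in
  \<open>funpow_order\<close>.\<close>

locale cyclic_extension = K: complex_subfield K + subfield_endo L \<sigma>
  for K L \<sigma> +
  assumes K_subset_L: "K \<subseteq> L"
    and bij: "bij_betw \<sigma> L L"
    and fixes_K: "x \<in> K \<Longrightarrow> \<sigma> x = x"
    and fixed_in_K: "x \<in> L \<Longrightarrow> \<sigma> x = x \<Longrightarrow> x \<in> K"
begin

lemma funpow_inj: "inj_on (\<sigma> ^^ m) L"
  using bij_betw_funpow[OF bij] by (auto simp: bij_betw_def)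

lemma funpow_closed [simp, intro]: "x \<in> L \<Longrightarrow> (\<sigma> ^^ m) x \<in> L"
  by (induction m) auto

lemma funpow_fixes_K: "x \<in> K \<Longrightarrow> (\<sigma> ^^ m) x = x"
  by (induction m) (auto simp: fixes_K)

text \<open>The coefficients of the orbit polynomial are fixed by \<open>\<sigma>\<close>.\<close>

lemma orbit_poly_coeff:
  assumes x: "x \<in> L" and cycle: "(\<sigma> ^^ m) x = x"
  shows "Polynomial.coeff (\<Prod>i<m. [:- (\<sigma> ^^ i) x, 1:]) k \<in> K"
proof -
  let ?P = "\<Prod>i<m. [:- (\<sigma> ^^ i) x, 1:]"
  have P: "map_poly \<sigma> ?P = (\<Prod>i<m. [:- \<sigma> ((\<sigma> ^^ i) x), 1:])" "Polynomial.coeff ?P k \<in> L"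
    using map_poly_linear_prod[of "{..<m}" "\<lambda>i. (\<sigma> ^^ i) x"] x by auto
  have "(\<Prod>i<m. [:- (\<sigma> ^^ Suc i) x, 1:]) = ?P"
  proof (cases m)
    case (Suc l)
    then have "(\<sigma> ^^ Suc l) x = x" using cycle by simp
    then show ?thesis
      unfolding Suc
      by (subst prod.lessThan_Suc, subst prod.lessThan_Suc_shift) (simp del: funpow.simps(2) add: mult.commute)
  qed simp
  then have "map_poly \<sigma> ?P = ?P" using P(1) by simp
  then have "\<sigma> (Polynomial.coeff ?P k) = Polynomial.coeff ?P k"
    by (metis coeff_map_poly zero)
  with P(2) show ?thesis by (rule fixed_in_K)
qed

text \<open>\<open>generate_field\<close> closes under inverses, so the point is that K[\<alpha>] is
  already a field. The orbit polynomial of \<open>h\<close> has coefficients in \<open>K\<close>,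
  the root \<open>h\<close> and, for nonzero \<open>h\<close>, a nonzero constant term
  \<open>c\<close>; writing it as \<open>pCons c q\<close> gives \<open>h * poly q h = - c\<close>,
  which expresses the inverse of \<open>h\<close> as a polynomial in \<open>h\<close>.\<close>

lemma adjoin_closed:
  assumes \<alpha>: "\<alpha> \<in> L" and gen: "L = generate_field CC (insert \<alpha> K)"
    and "0 < m" and cycle: "\<And>x. x \<in> L \<Longrightarrow> (\<sigma> ^^ m) x = x" and "x \<in> L"
  shows "\<exists>q. (\<forall>k. Polynomial.coeff q k \<in> K) \<and> x = poly q \<alpha>"
proof -
  let ?S = "{poly q \<alpha> | q. \<forall>k. Polynomial.coeff q k \<in> K}"
  have SI: "poly q \<alpha> \<in> ?S" if "\<And>k. Polynomial.coeff q k \<in> K" for q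
    using that by blast
  have const: "c \<in> ?S" if "c \<in> K" for c
    using SI[of "[:c:]"] that by (simp add: coeff_pCons split: nat.split)
  have plus: "u + v \<in> ?S" if uv: "u \<in> ?S" "v \<in> ?S" for u v
  proof -
    obtain a b where "\<forall>k. Polynomial.coeff a k \<in> K" "u = poly a \<alpha>"
        "\<forall>k. Polynomial.coeff b k \<in> K" "v = poly b \<alpha>"
      using uv by blast
    then show ?thesis using SI[of "a + b"] by simp
  qed
  have times: "u * v \<in> ?S" if uv: "u \<in> ?S" "v \<in> ?S" for u v
  proof -
    obtain a b where "\<forall>k. Polynomial.coeff a k \<in> K" "u = poly a \<alpha>"
        "\<forall>k. Polynomial.coeff b k \<in> K" "v = poly b \<alpha>"
      using uv by blast
    then show ?thesis using SI[of "a * b"] by (simp add: coeff_mult K.sum_mem)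
  qed
  \<comment> \<open>Needed for \<open>poly q h\<close> in the inverse case, where \<open>h\<close>
    is itself a polynomial in \<alpha>.\<close>
  have poly_S: "poly q u \<in> ?S" if "u \<in> ?S" "\<And>k. Polynomial.coeff q k \<in> K" for q u
    using that(2)
  proof (induction q)
    case 0 then show ?case using const[of 0] by simp
  next
    case (pCons a q)
    have a: "a \<in> K" and q: "\<And>k. Polynomial.coeff q k \<in> K"
      using pCons.prems[of 0] pCons.prems[of "Suc _"] by simp_all
    show ?case
      unfolding poly_pCons by (rule plus[OF const[OF a] times[OF that(1) pCons.IH[OF q]]])
  qed
  have "x \<in> ?S" using \<open>x \<in> L\<close> unfolding gen
  proof (induction rule: generate_field.induct)
    case one then show ?case using const[of 1] by simp
  next
    case (incl h)
    have "\<alpha> \<in> ?S" using SI[of "[:0, 1:]"] by (simp add: coeff_pCons split: nat.split)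
    with incl show ?case using const by auto
  next
    case (a_inv h)
    then show ?case using times[of "- 1" h] const[of "- 1"] by simp
  next
    case (eng_add h1 h2) then show ?case using plus by simp
  next
    case (eng_mult h1 h2) then show ?case using times by simp
  next
    case (m_inv h)
    then have h: "h \<in> L" "h \<noteq> 0" using gen by auto
    define g where "g = (\<Prod>i<m. [:- (\<sigma> ^^ i) h, 1:])"
    show ?case
    proof -
      have gK: "Polynomial.coeff g k \<in> K" for k
        unfolding g_def by (rule orbit_poly_coeff[OF h(1) cycle[OF h(1)]])
      obtain c q where cq: "g = pCons c q" by (cases g) auto
      have "poly g h = (\<Prod>i<m. h - (\<sigma> ^^ i) h)"
        unfolding g_def poly_prod by simp
      also have "\<dots> = 0"
        using \<open>0 < m\<close> by (intro prod_zero) (auto intro!: bexI[of _ 0])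
      finally have "h * poly q h = - c" by (simp add: cq eq_neg_iff_add_eq_0 add.commute)
      moreover have "c = poly g 0" by (simp add: cq)
      then have "c = (\<Prod>i<m. - (\<sigma> ^^ i) h)"
        unfolding g_def poly_prod by simp
      moreover have "(\<sigma> ^^ i) h \<noteq> 0" for i
      proof
        interpret fi: subfield_endo L "\<sigma> ^^ i" by (rule funpow_endo)
        assume "(\<sigma> ^^ i) h = 0"
        then show False
          using inj_onD[OF funpow_inj, of i h 0] h by simp
      qed
      ultimately have "c \<noteq> 0" "inverse h = - inverse c * poly q h"
        using h by (auto simp: field_simps)
      moreover have "c \<in> K" "\<And>k. Polynomial.coeff q k \<in> K"
        using gK[of 0] gK[of "Suc _"] by (simp_all add: cq)
      ultimately have "inverse h \<in> ?S"
        using times[OF const[of "- inverse c"] poly_S[of h q]] m_inv by (simp del: mem_Collect_eq)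
      then show ?thesis using h by (simp add: CC_m_inv del: mem_Collect_eq)
    qed
  qed
  then show ?thesis by blast
qed

text \<open>\<alpha> is a root of a nonzero polynomial over \<open>K\<close> of degree at most
  \<open>n\<close>, so among its first \<open>n + 1\<close> conjugates two coincide and \<alpha> has
  a period \<open>m \<le> n\<close>. Conversely the orbit polynomial of degree \<open>m\<close>
  shows that \<open>m\<close> powers of \<alpha> span \<open>L\<close>, whence
  \<open>n \<le> m\<close>.\<close>

lemma funpow_order:
  assumes dim: "CC.dimension n K L"
    and \<alpha>: "\<alpha> \<in> L" and gen: "L = generate_field CC (insert \<alpha> K)"
  shows "0 < n" and "x \<in> L \<Longrightarrow> (\<sigma> ^^ n) x = x"
proof -
  obtain c where c: "\<forall>i\<le>n. c i \<in> K" "\<exists>i\<le>n. c i \<noteq> 0" "(\<Sum>i\<le>n. c i * \<alpha> ^ i) = 0"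
    using K.linear_dependence[OF dim, of "\<lambda>i. \<alpha> ^ i"] \<alpha> by auto
  define q where "q = (\<Sum>i\<le>n. Polynomial.monom (c i) i)"
  have coeff_q: "Polynomial.coeff q i = (if i \<le> n then c i else 0)" for i
    by (simp add: q_def coeff_sum if_distrib[of "\<lambda>x. x i"] cong: if_cong)
  have "q \<noteq> 0" using c(2) coeff_q by (metis Polynomial.coeff_0)
  have "Polynomial.degree q \<le> n" by (rule degree_le) (simp add: coeff_q)
  have root: "(\<sigma> ^^ i) \<alpha> \<in> {y. poly q y = 0}" for i
  proof -
    interpret fi: subfield_endo L "\<sigma> ^^ i" by (rule funpow_endo)
    have "poly q ((\<sigma> ^^ i) \<alpha>) = (\<Sum>j\<le>n. c j * (\<sigma> ^^ i) \<alpha> ^ j)"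
      by (simp add: q_def poly_sum poly_monom)
    also have "\<dots> = (\<Sum>j\<le>n. (\<sigma> ^^ i) (c j * \<alpha> ^ j))"
      using c(1) \<alpha> K_subset_L
      by (intro sum.cong) (auto simp: fi.mult fi.power funpow_fixes_K subset_eq)
    also have "\<dots> = (\<sigma> ^^ i) (\<Sum>j\<le>n. c j * \<alpha> ^ j)"
      using c(1) \<alpha> K_subset_L by (intro fi.sum[symmetric]) auto
    finally show ?thesis by (simp add: c(3))
  qed
  have "card {y. poly q y = 0} \<le> n"
    using card_poly_roots_bound[OF \<open>q \<noteq> 0\<close>] \<open>Polynomial.degree q \<le> n\<close> by simp
  moreover have "(\<lambda>i. (\<sigma> ^^ i) \<alpha>) ` {..n} \<subseteq> {y. poly q y = 0}"
    using root by blast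
  then have "card ((\<lambda>i. (\<sigma> ^^ i) \<alpha>) ` {..n}) \<le> card {y. poly q y = 0}"
    by (intro card_mono poly_roots_finite \<open>q \<noteq> 0\<close>)
  ultimately have "\<not> inj_on (\<lambda>i. (\<sigma> ^^ i) \<alpha>) {..n}"
    by (intro pigeonhole) simp
  then obtain i j where ij: "i < j" "j \<le> n" "(\<sigma> ^^ i) \<alpha> = (\<sigma> ^^ j) \<alpha>"
    unfolding inj_on_def by (metis atMost_iff linorder_neqE_nat)
  \<comment> \<open>Injectivity of \<open>\<sigma> ^^ i\<close> cancels the common part of the
    coincidence, so \<alpha> returns after \<open>m\<close> steps; what fixes \<alpha> and
    \<open>K\<close> fixes all of \<open>L\<close>.\<close>
  define m where "m = j - i"
  have m: "0 < m" "m \<le> n" using ij by (auto simp: m_def)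
  have "(\<sigma> ^^ i) ((\<sigma> ^^ m) \<alpha>) = (\<sigma> ^^ i) \<alpha>"
    using ij by (simp add: m_def funpow_add[symmetric, unfolded comp_def, THEN fun_cong] flip: comp_apply[of "\<sigma> ^^ i"] funpow_add)
  then have m_\<alpha>: "(\<sigma> ^^ m) \<alpha> = \<alpha>"
    using inj_onD[OF funpow_inj] \<alpha> by blast
  interpret fm: subfield_endo L "\<sigma> ^^ m" by (rule funpow_endo)
  have cycle: "(\<sigma> ^^ m) x = x" if "x \<in> L" for x
  proof -
    have "x \<in> generate_field CC (insert \<alpha> K)" using that gen by simp
    then have "x \<in> L \<and> (\<sigma> ^^ m) x = x"
    proof (induction rule: generate_field.induct)
      case (incl h) then show ?case using m_\<alpha> \<alpha> K_subset_L by (auto simp: funpow_fixes_K)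
    qed (auto simp: fm.uminus fm.add fm.mult fm.inverse CC_m_inv)
    then show ?thesis by simp
  qed
  \<comment> \<open>The span of the first \<open>m\<close> powers of \<alpha>. It contains every
    power once it is closed under multiplication by \<alpha>, and the only critical case of that is
    \<open>\<alpha> ^ m\<close>.\<close>
  define S where "S = {\<Sum>i<m. c i * \<alpha> ^ i | c. \<forall>i<m. c i \<in> K}"
  have S_add: "u + v \<in> S" if uv: "u \<in> S" "v \<in> S" for u v
  proof -
    obtain a b where "\<forall>i<m. a i \<in> K" "u = (\<Sum>i<m. a i * \<alpha> ^ i)" "\<forall>i<m. b i \<in> K" "v = (\<Sum>i<m. b i * \<alpha> ^ i)"
      using uv unfolding S_def by blast
    then show ?thesis
      unfolding S_def by (intro CollectI exI[of _ "\<lambda>i. a i + b i"]) (auto simp: sum.distrib distrib_right)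
  qed
  have S_scale: "k * u \<in> S" if ku: "k \<in> K" "u \<in> S" for k u
  proof -
    obtain a where "\<forall>i<m. a i \<in> K" "u = (\<Sum>i<m. a i * \<alpha> ^ i)"
      using ku unfolding S_def by blast
    then show ?thesis
      unfolding S_def using ku
      by (intro CollectI exI[of _ "\<lambda>i. k * a i"]) (auto simp: sum_distrib_left mult.assoc)
  qed
  have S_zero: "0 \<in> S"
    unfolding S_def by (intro CollectI exI[of _ "\<lambda>i. 0"]) auto
  have S_sum: "sum u I \<in> S" if "\<And>i. i \<in> I \<Longrightarrow> u i \<in> S" for u and I :: "nat set"
    using that by (induction I rule: infinite_finite_induct) (auto simp: S_add S_zero)
  have S_low: "\<alpha> ^ j \<in> S" if "j < m" for j
    unfolding S_def using that
    by (intro CollectI exI[of _ "\<lambda>i. of_bool (i = j)"]) (auto simp: if_distrib[of "\<lambda>x. x * _"] of_bool_def cong: if_cong)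
  have S_m: "\<alpha> ^ m \<in> S"
  proof -
    \<comment> \<open>The orbit polynomial is monic of degree \<open>m\<close> over \<open>K\<close>
      and vanishes at \<alpha>, hence rewrites \<open>\<alpha> ^ m\<close> by lower powers.\<close>
    define g where "g = (\<Prod>i<m. [:- (\<sigma> ^^ i) \<alpha>, 1:])"
    have gK: "Polynomial.coeff g k \<in> K" for k
      unfolding g_def by (rule orbit_poly_coeff[OF \<alpha> m_\<alpha>])
    have "Polynomial.degree g = m"
      unfolding g_def by (subst degree_prod_eq_sum_degree) auto
    moreover have "Polynomial.lead_coeff g = 1"
      unfolding g_def lead_coeff_prod by simp
    moreover have "poly g \<alpha> = 0"
      unfolding g_def poly_prod using \<open>0 < m\<close> by (intro prod_zero) (auto intro!: bexI[of _ 0])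
    ultimately have "(\<Sum>i<m. Polynomial.coeff g i * \<alpha> ^ i) + \<alpha> ^ m = 0"
      by (simp add: poly_altdef flip: lessThan_Suc_atMost)
    then have "\<alpha> ^ m = (\<Sum>i<m. - Polynomial.coeff g i * \<alpha> ^ i)"
      by (simp add: sum_negf eq_neg_iff_add_eq_0 add.commute)
    also have "\<dots> \<in> S"
      using gK by (intro S_sum S_scale S_low) auto
    finally show ?thesis .
  qed
  have S_shift: "\<alpha> * u \<in> S" if "u \<in> S" for u
  proof -
    obtain a where a: "\<forall>i<m. a i \<in> K" "u = (\<Sum>i<m. a i * \<alpha> ^ i)"
      using \<open>u \<in> S\<close> unfolding S_def by blast
    have "\<alpha> * u = (\<Sum>i<m. a i * \<alpha> ^ Suc i)"
      by (simp add: a(2) sum_distrib_left mult_ac)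
    also have "\<dots> \<in> S"
    proof (intro S_sum S_scale)
      fix i assume "i \<in> {..<m}"
      then consider "Suc i < m" | "Suc i = m" by fastforce
      then show "\<alpha> ^ Suc i \<in> S" using S_low S_m by cases metis+
    qed (use a(1) in auto)
    finally show ?thesis .
  qed
  have S_power: "\<alpha> ^ k \<in> S" for k
    using S_low[of 0] \<open>0 < m\<close> by (induction k) (auto intro: S_shift)
  have "n \<le> m"
  proof (rule K.dimension_le_spanning[OF dim])
    fix x assume "x \<in> L"
    then obtain q where "\<forall>k. Polynomial.coeff q k \<in> K" "x = poly q \<alpha>"
      using adjoin_closed[OF \<alpha> gen \<open>0 < m\<close> cycle] by blast
    then have "x \<in> S"
      unfolding poly_altdef by (auto intro!: S_sum S_scale S_power)
    then show "\<exists>c. (\<forall>i<m. c i \<in> K) \<and> x = (\<Sum>i<m. c i * \<alpha> ^ i)"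
      unfolding S_def by blast
  qed
  with m show "0 < n" "x \<in> L \<Longrightarrow> (\<sigma> ^^ n) x = x"
    using cycle by simp_all
qed

end

section \<open>Integers of imaginary quadratic fields\<close>

definition algebraic_ints :: "complex set \<Rightarrow> complex set"
  where "algebraic_ints F = {x \<in> F. algebraic_int x}"

lemma ring_of_integers_ops [simp]:
  "carrier (ring_of_integers F) = algebraic_ints F" "x \<otimes>\<^bsub>ring_of_integers F\<^esub> y = x * y"
  "x \<oplus>\<^bsub>ring_of_integers F\<^esub> y = x + y" "\<one>\<^bsub>ring_of_integers F\<^esub> = 1" "\<zero>\<^bsub>ring_of_integers F\<^esub> = 0"
  by (simp_all add: ring_of_integers_def algebraic_ints_def)

lemma complex_subfield_Rats: "complex_subfield \<rat>"
proof (rule complex_subfield.intro)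
  show "subfield \<rat> CC"
  proof (rule field.subfieldI'[OF field_from_type_algebra])
    show "subring \<rat> CC" by (rule CC.subringI) auto
  next
    fix k assume "k \<in> \<rat> - {\<zero>\<^bsub>CC\<^esub>}"
    then show "inv\<^bsub>CC\<^esub> k \<in> \<rat>" by (auto simp: CC_m_inv)
  qed
qed

lemma Rats_Im: "x \<in> \<rat> \<Longrightarrow> Im x = 0"
  by (elim Rats_cases') (metis Reals_divide Reals_of_int complex_is_Real_iff)

lemma Ints_norm_ge_1:
  assumes "x \<in> \<int>" "x \<noteq> 0"
  shows "1 \<le> cmod x"
proof -
  obtain k where "x = of_int k" using assms(1) by (auto elim: Ints_cases)
  with assms(2) show ?thesis by simp
qed

lemma sum_le_2: "(\<Sum>i\<le>2. f i) = f 0 + f 1 + f (2::nat)" for f :: "nat \<Rightarrow> 'a::comm_monoid_add"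
  by (simp add: numeral_2_eq_2)

text \<open>Three elements of \<open>K\<close> are dependent over the rationals. In a relation
  between 1, the real \<open>x\<close> and a nonreal \<open>y\<close>, the imaginary part removes
  \<open>y\<close>, and what remains solves for \<open>x\<close>.\<close>

lemma imaginary_quadratic_real_subset_Rats:
  assumes K: "imaginary_quadratic K" and x: "x \<in> K" "Im x = 0"
  shows "x \<in> \<rat>"
proof -
  interpret Q: complex_subfield \<rat> by (rule complex_subfield_Rats)
  interpret K: complex_subfield K
    using K by (intro complex_subfield.intro) (simp add: imaginary_quadratic_def)
  have dim: "CC.dimension 2 \<rat> K" using K by (simp add: imaginary_quadratic_def)
  obtain y where y: "y \<in> K" "Im y \<noteq> 0"
    using K unfolding imaginary_quadratic_def complex_is_Real_iff[symmetric] by blast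
  define f where "f i = (if i = 0 then 1 else if i = 1 then x else y)" for i :: nat
  have "\<exists>c. (\<forall>i\<le>2. c i \<in> \<rat>) \<and> (\<exists>i\<le>2. c i \<noteq> 0) \<and> (\<Sum>i\<le>2. c i * f i) = 0"
    using x y by (intro Q.linear_dependence[OF dim]) (auto simp: f_def)
  then obtain c :: "nat \<Rightarrow> complex" where c: "\<And>i. i \<le> 2 \<Longrightarrow> c i \<in> \<rat>" "\<exists>i\<le>2. c i \<noteq> 0" "c 0 + c 1 * x + c 2 * y = 0"
    by (auto simp: sum_le_2 f_def)
  have Im_c: "Im (c 0) = 0" "Im (c 1) = 0" "Im (c 2) = 0"
    using c(1) by (auto intro!: Rats_Im)
  have "Re (c 2) * Im y = 0"
    using arg_cong[OF c(3), of Im] Im_c x by simp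
  then have c2: "c 2 = 0" using y Im_c by (simp add: complex_eq_iff)
  have c1: "c 1 \<noteq> 0"
  proof
    assume "c 1 = 0"
    then have "c 0 = 0" using c(3) c2 by simp
    with \<open>c 1 = 0\<close> c2 c(2) show False
      by (metis One_nat_def le_neq_implies_less less_2_cases)
  qed
  have "c 1 * x = - c 0" using c(3) c2 by (simp add: eq_neg_iff_add_eq_0 add.commute)
  then have "x = - c 0 / c 1" using c1 by (simp add: field_simps)
  then show ?thesis using c(1)[of 0] c(1)[of 1] by simp
qed

text \<open>A real \<open>x\<close> is a rational integer. For nonreal \<open>x\<close> the
  imaginary part of its quadratic equation identifies the second root as \<open>cnj x\<close>, which
  therefore lies in \<open>K\<close>, and \<open>x * cnj x\<close> is the rational constant term.
  Being also an algebraic integer, this squared absolute value is a nonzero integer.\<close>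

lemma imaginary_quadratic_norm_ge_1:
  assumes K: "imaginary_quadratic K" and mult: "\<And>x y. x \<in> algebraic_ints K \<Longrightarrow> y \<in> algebraic_ints K \<Longrightarrow> x * y \<in> algebraic_ints K"
    and x: "x \<in> algebraic_ints K" "x \<noteq> 0"
  shows "1 \<le> cmod x"
proof (cases "Im x = 0")
  case True
  then have "x \<in> \<int>"
    using x imaginary_quadratic_real_subset_Rats[OF K]
    by (auto simp: algebraic_ints_def intro: rational_algebraic_int_is_int)
  then show ?thesis using x(2) by (rule Ints_norm_ge_1)
next
  case False
  interpret Q: complex_subfield \<rat> by (rule complex_subfield_Rats)
  interpret K: complex_subfield K
    using K by (intro complex_subfield.intro) (simp add: imaginary_quadratic_def)
  have dim: "CC.dimension 2 \<rat> K" using K by (simp add: imaginary_quadratic_def)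
  have "\<exists>c. (\<forall>i\<le>2. c i \<in> \<rat>) \<and> (\<exists>i\<le>2. c i \<noteq> 0) \<and> (\<Sum>i\<le>2. c i * x ^ i) = 0"
    using x by (intro Q.linear_dependence[OF dim]) (auto simp: algebraic_ints_def)
  then obtain c :: "nat \<Rightarrow> complex" where c: "\<And>i. i \<le> 2 \<Longrightarrow> c i \<in> \<rat>" "\<exists>i\<le>2. c i \<noteq> 0" "c 0 + c 1 * x + c 2 * x\<^sup>2 = 0"
    by (auto simp: sum_le_2)
  have Im_c: "Im (c 0) = 0" "Im (c 1) = 0" "Im (c 2) = 0"
    using c(1) by (auto intro!: Rats_Im)
  have c2: "c 2 \<noteq> 0"
  proof
    assume "c 2 = 0"
    then have *: "c 0 + c 1 * x = 0" using c(3) by simp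
    have "Re (c 1) * Im x = 0" using arg_cong[OF *, of Im] Im_c by simp
    then have "c 1 = 0" using False Im_c by (simp add: complex_eq_iff)
    moreover from this have "c 0 = 0" using * by simp
    ultimately show False using \<open>c 2 = 0\<close> c(2)
      by (metis One_nat_def le_neq_implies_less less_2_cases)
  qed
  define b where "b = Re (c 1 / c 2)"
  have b: "c 1 / c 2 = of_real b"
    using Im_c by (simp add: b_def complex_eq_iff Im_divide)
  have rat: "c 0 / c 2 \<in> \<rat>" "complex_of_real b \<in> \<rat>"
    using c(1) by (simp_all flip: b)
  have quad: "x\<^sup>2 + of_real b * x + c 0 / c 2 = 0"
  proof -
    have "x\<^sup>2 + of_real b * x + c 0 / c 2 = (c 0 + c 1 * x + c 2 * x\<^sup>2) / c 2"
      using c2 unfolding b[symmetric] by (simp add: add_divide_distrib)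
    then show ?thesis by (simp only: c(3) div_0)
  qed
  have "Im (c 0 / c 2) = 0" using rat by (rule_tac Rats_Im)
  then have "2 * Re x * Im x + b * Im x = 0"
    using arg_cong[OF quad, of Im] by (simp add: power2_eq_square algebra_simps del: Im_divide)
  then have "(b + 2 * Re x) * Im x = 0" by (simp add: algebra_simps)
  then have "b = - 2 * Re x" using False by simp
  then have cnj_x: "cnj x = - of_real b - x"
    by (simp add: complex_eq_iff)
  have "of_real b \<in> K"
    using rat(2) by (auto elim!: Rats_cases' simp: K.of_int_mem intro!: K.divide_mem)
  then have "cnj x \<in> algebraic_ints K"
    using x unfolding algebraic_ints_def by (simp add: cnj_x[symmetric]) (simp add: cnj_x K.diff_mem K.uminus_mem)
  then have "x * cnj x \<in> algebraic_ints K"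
    using x mult by blast
  moreover have "x * cnj x = c 0 / c 2 - (x\<^sup>2 + of_real b * x + c 0 / c 2)"
    by (simp add: cnj_x algebra_simps power2_eq_square)
  then have "x * cnj x = c 0 / c 2" by (simp only: quad diff_0_right)
  ultimately have "x * cnj x \<in> \<int>"
    using rat(1) by (auto simp: algebraic_ints_def intro: rational_algebraic_int_is_int)
  then have "1 \<le> cmod (x * cnj x)"
    using x(2) by (intro Ints_norm_ge_1) auto
  then have "1 \<le> (cmod x)\<^sup>2"
    by (simp add: norm_mult power2_eq_square)
  then show ?thesis
    by (metis norm_ge_zero one_power2 power2_le_imp_le)
qed

section \<open>Divisibility by an inert element\<close>

text \<open>Inertness is recast without ideals: \<open>p_prime\<close> is primality in the integers
  of \<open>L\<close>, and \<open>p_norm\<close> expresses that \<open>p\<close> is not a unit in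
  those of \<open>K\<close>. \<open>K_norm_ge_1\<close> is the only source of lower bounds on
  absolute values.\<close>

locale inert_extension = cyclic_extension K L \<sigma> for K L \<sigma> +
  fixes n :: nat and p :: complex
  assumes n_pos: "0 < n" and order: "x \<in> L \<Longrightarrow> (\<sigma> ^^ n) x = x"
    and O_add [intro]: "x \<in> algebraic_ints L \<Longrightarrow> y \<in> algebraic_ints L \<Longrightarrow> x + y \<in> algebraic_ints L"
    and O_mult [intro]: "x \<in> algebraic_ints L \<Longrightarrow> y \<in> algebraic_ints L \<Longrightarrow> x * y \<in> algebraic_ints L"
    and K_norm_ge_1: "x \<in> algebraic_ints K \<Longrightarrow> x \<noteq> 0 \<Longrightarrow> 1 \<le> cmod x"
    and p_mem: "p \<in> algebraic_ints K"
    and p_norm: "1 < cmod p"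
    and p_prime: "x \<in> algebraic_ints L \<Longrightarrow> y \<in> algebraic_ints L \<Longrightarrow> z \<in> algebraic_ints L \<Longrightarrow>
      x * y = p * z \<Longrightarrow> (\<exists>w\<in>algebraic_ints L. x = p * w) \<or> (\<exists>w\<in>algebraic_ints L. y = p * w)"
begin

abbreviation OL :: "complex set"
  where "OL \<equiv> algebraic_ints L"

definition p_dvd :: "complex \<Rightarrow> bool"
  where "p_dvd x \<longleftrightarrow> (\<exists>y\<in>OL. x = p * y)"

lemma OL_0 [simp]: "0 \<in> OL" and OL_1 [simp]: "1 \<in> OL"
  and OL_uminus [intro]: "x \<in> OL \<Longrightarrow> - x \<in> OL"
  unfolding algebraic_ints_def by (auto intro: int_imp_algebraic_int)

lemma algebraic_ints_K_iff: "x \<in> algebraic_ints K \<longleftrightarrow> x \<in> OL \<and> x \<in> K"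
  using K_subset_L by (auto simp: algebraic_ints_def)

lemma funpow_OL: "x \<in> OL \<Longrightarrow> (\<sigma> ^^ m) x \<in> OL"
  using subfield_endo.algebraic_int_image[OF funpow_endo] by (auto simp: algebraic_ints_def)

lemma OL_in_L [simp, intro]: "x \<in> OL \<Longrightarrow> x \<in> L"
  by (simp add: algebraic_ints_def)

lemma p_OL [simp]: "p \<in> OL" and p_K: "p \<in> K" and p_L [simp]: "p \<in> L"
  using p_mem by (auto simp: algebraic_ints_K_iff)

lemma p_nonzero: "p \<noteq> 0"
  using p_norm by auto

lemma funpow_p [simp]: "(\<sigma> ^^ m) p = p"
  by (rule funpow_fixes_K[OF p_K])

lemma OL_prod: "(\<And>i. i \<in> I \<Longrightarrow> f i \<in> OL) \<Longrightarrow> prod f I \<in> OL"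
  by (induction I rule: infinite_finite_induct) auto

lemma OL_sum: "(\<And>i. i \<in> I \<Longrightarrow> f i \<in> OL) \<Longrightarrow> sum f I \<in> OL"
  by (induction I rule: infinite_finite_induct) auto

lemma OL_power: "x \<in> OL \<Longrightarrow> x ^ m \<in> OL"
  by (induction m) auto

lemma OL_signof: "signof q \<in> OL"
  by (auto simp: sign_def)

lemma funpow_mult: "x \<in> L \<Longrightarrow> y \<in> L \<Longrightarrow> (\<sigma> ^^ m) (x * y) = (\<sigma> ^^ m) x * (\<sigma> ^^ m) y"
  by (rule subfield_endo.mult[OF funpow_endo])

lemma funpow_nonzero: "x \<in> L \<Longrightarrow> x \<noteq> 0 \<Longrightarrow> (\<sigma> ^^ m) x \<noteq> 0"
  using inj_onD[OF funpow_inj, of m x 0] subfield_endo.zero[OF funpow_endo, of m] by auto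

text \<open>Applying \<sigma> rotates the factors, so the product is a nonzero integer of
  \<open>K\<close>. It is used with \<open>m = n\<close>, a norm, and with \<open>m = U\<close>, for
  determinants.\<close>

lemma orbit_prod_norm_ge_1:
  assumes x: "x \<in> OL" "x \<noteq> 0" and cycle: "(\<sigma> ^^ m) x = x"
  shows "1 \<le> (\<Prod>i<m. cmod ((\<sigma> ^^ i) x))"
proof -
  let ?P = "\<Prod>i<m. (\<sigma> ^^ i) x"
  have "\<sigma> ?P = (\<Prod>i<m. (\<sigma> ^^ Suc i) x)"
    using x by (subst prod) auto
  also have "\<dots> = ?P"
  proof (cases m)
    case (Suc l)
    then have "(\<sigma> ^^ Suc l) x = x" using cycle by simp
    then show ?thesis
      unfolding Suc
      by (subst prod.lessThan_Suc, subst prod.lessThan_Suc_shift) (simp del: funpow.simps(2) add: mult.commute)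
  qed simp
  finally have "?P \<in> K"
    using x by (intro fixed_in_K prod_mem) auto
  moreover have "?P \<in> OL"
    using x by (intro OL_prod funpow_OL)
  ultimately have "?P \<in> algebraic_ints K"
    by (simp add: algebraic_ints_K_iff)
  moreover have "?P \<noteq> 0"
    using x funpow_nonzero by auto
  ultimately have "1 \<le> cmod ?P" by (rule K_norm_ge_1)
  then show ?thesis by (simp add: prod_norm)
qed

text \<open>Taking the product over all \<open>n\<close> conjugates turns divisibility by
  \<open>p ^ m\<close> into size: the cofactor contributes at least 1 and \<open>p\<close> has
  absolute value greater than 1.\<close>

lemma p_power_dvd_bounded:
  assumes "x \<in> OL" "x \<noteq> 0"
  shows "\<exists>M. \<forall>m y. y \<in> OL \<longrightarrow> x = p ^ m * y \<longrightarrow> m \<le> M"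
proof -
  let ?C = "\<Prod>i<n. cmod ((\<sigma> ^^ i) x)"
  obtain M where M: "?C < cmod p ^ M"
    using real_arch_pow[OF p_norm] by blast
  have "m \<le> M" if y: "y \<in> OL" "x = p ^ m * y" for m y
  proof -
    have "(\<sigma> ^^ i) x = p ^ m * (\<sigma> ^^ i) y" for i
      using y(1) subfield_endo.power[OF funpow_endo, of p] by (simp add: y(2) funpow_mult)
    then have "?C = (cmod p ^ m) ^ n * (\<Prod>i<n. cmod ((\<sigma> ^^ i) y))"
      by (simp add: norm_mult norm_power prod.distrib)
    moreover have "1 \<le> (\<Prod>i<n. cmod ((\<sigma> ^^ i) y))"
      using assms y order by (intro orbit_prod_norm_ge_1) auto
    ultimately have "(cmod p ^ m) ^ n * 1 \<le> ?C"
      by (metis mult_left_mono norm_ge_zero zero_le_power)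
    moreover have "cmod p ^ m \<le> (cmod p ^ m) ^ n"
      using p_norm n_pos by (intro self_le_power one_le_power) auto
    ultimately have "cmod p ^ m < cmod p ^ M"
      using M by simp
    then show ?thesis
      using p_norm by (simp add: power_strict_increasing_iff)
  qed
  then show ?thesis by blast
qed

text \<open>Otherwise the inverse of \<open>p\<close> would be a nonzero integer of \<open>K\<close>
  of absolute value below 1.\<close>

lemma not_p_dvd_1: "\<not> p_dvd 1"
proof
  assume "p_dvd 1"
  then obtain y where y: "y \<in> OL" "1 = p * y" by (auto simp: p_dvd_def)
  then have "y = inverse p" using inverse_unique by metis
  then have "y \<in> algebraic_ints K" "y \<noteq> 0"
    using y p_K p_nonzero by (auto simp: algebraic_ints_K_iff)
  then have "1 \<le> cmod y" by (rule K_norm_ge_1)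
  moreover have "cmod p * cmod y = 1" using y(2) by (metis norm_mult norm_one)
  ultimately show False
    using p_norm mult_left_mono[of 1 "cmod y" "cmod p"] by simp
qed

lemma not_p_dvd_prod:
  "(\<And>i. i \<in> I \<Longrightarrow> f i \<in> OL \<and> \<not> p_dvd (f i)) \<Longrightarrow> \<not> p_dvd (prod f I)"
proof (induction I rule: infinite_finite_induct)
  case (insert i I)
  then have "\<not> p_dvd (f i)" "\<not> p_dvd (prod f I)" "f i \<in> OL" "prod f I \<in> OL"
    by (auto intro: OL_prod)
  then show ?case
    using p_prime[of "f i" "prod f I"] insert.hyps by (auto simp: p_dvd_def)
qed (auto simp: not_p_dvd_1)

lemma p_dvd_uminus: "p_dvd (- x) \<Longrightarrow> p_dvd x"
  unfolding p_dvd_def using OL_uminus by (metis minus_minus mult_minus_right)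

lemma funpow_multiple_order: "x \<in> L \<Longrightarrow> (\<sigma> ^^ (m * n)) x = x"
  by (induction m) (simp_all add: funpow_add order)

lemma p_dvd_funpow:
  assumes "x \<in> OL" "p_dvd ((\<sigma> ^^ m) x)"
  shows "p_dvd x"
proof -
  obtain y where y: "y \<in> OL" "(\<sigma> ^^ m) x = p * y" using assms(2) by (auto simp: p_dvd_def)
  \<comment> \<open>\<open>\<sigma> ^^ (m * n - m)\<close> undoes \<open>\<sigma> ^^ m\<close>; the
    inequality keeps the subtraction from truncating.\<close>
  have "m \<le> m * n" using n_pos by simp
  then have "x = (\<sigma> ^^ (m * n - m)) ((\<sigma> ^^ m) x)"
    using funpow_multiple_order[of x m] assms(1) by (simp flip: funpow_add comp_apply[of "\<sigma> ^^ (m * n - m)"])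
  also have "\<dots> = p * (\<sigma> ^^ (m * n - m)) y"
    using y by (simp add: funpow_mult)
  finally show ?thesis
    using y funpow_OL unfolding p_dvd_def by blast
qed

text \<open>The ultrametric principle with explicit cofactors in place of a valuation: if the sum
  vanished, cancelling \<open>p ^ e\<close> would make \<open>u\<close> divisible by
  \<open>p\<close>.\<close>

lemma sum_nonzero_of_unique_min:
  assumes T: "finite T" "a \<in> T" and min: "t a = p ^ e * u" "u \<in> OL" "\<not> p_dvd u"
    and others: "\<And>b. b \<in> T - {a} \<Longrightarrow> \<exists>v\<in>OL. t b = p ^ Suc e * v"
  shows "sum t T \<noteq> 0"
proof
  assume "sum t T = 0"
  obtain v where v: "\<And>b. b \<in> T - {a} \<Longrightarrow> v b \<in> OL \<and> t b = p ^ Suc e * v b"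
    using others by metis
  have "sum t T = t a + (\<Sum>b\<in>T - {a}. t b)"
    using T by (rule sum.remove)
  also have "(\<Sum>b\<in>T - {a}. t b) = p ^ Suc e * (\<Sum>b\<in>T - {a}. v b)"
    using v by (simp add: sum_distrib_left)
  finally have "p ^ e * (u + p * (\<Sum>b\<in>T - {a}. v b)) = 0"
    using \<open>sum t T = 0\<close> min(1) by (simp add: algebra_simps)
  then have "u = p * - (\<Sum>b\<in>T - {a}. v b)"
    using p_nonzero by (simp add: eq_neg_iff_add_eq_0)
  moreover have "- (\<Sum>b\<in>T - {a}. v b) \<in> OL"
    using v by (intro OL_uminus OL_sum) auto
  ultimately show False using min(3) unfolding p_dvd_def by blast
qed

text \<open>In the cyclic algebra \<open>nt * m + h\<close> is the valuation at \<open>u\<close> of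
  the element with coefficients \<open>x d\<close>: \<open>m\<close> is the largest common power of
  \<open>p\<close>, bounded because of \<open>x d0\<close>, and \<open>h\<close> is the first
  coefficient it exhausts.\<close>

lemma common_p_power:
  fixes x :: "nat \<Rightarrow> complex"
  assumes x: "\<And>d. d < nt \<Longrightarrow> x d \<in> OL" and nonzero: "d0 < nt" "x d0 \<noteq> 0"
  shows "\<exists>m y h. h < nt \<and> (\<forall>d<nt. y d \<in> OL \<and> x d = p ^ m * y d) \<and> \<not> p_dvd (y h) \<and> (\<forall>d<h. p_dvd (y d))"
proof -
  let ?P = "\<lambda>m. \<forall>d<nt. \<exists>y\<in>OL. x d = p ^ m * y"
  obtain M where M: "m \<le> M" if "y \<in> OL" "x d0 = p ^ m * y" for m y
    using p_power_dvd_bounded[OF x[OF nonzero(1)] nonzero(2)] by blast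
  have bounded: "m \<le> M" if "?P m" for m using that nonzero(1) M by blast
  define m where "m = (GREATEST m. ?P m)"
  have "?P 0" using x by auto
  then have "?P m" unfolding m_def by (rule GreatestI_nat[where b = M]) (use bounded in blast)
  then obtain y where y: "\<And>d. d < nt \<Longrightarrow> y d \<in> OL \<and> x d = p ^ m * y d" by metis
  have "\<not> ?P (Suc m)"
  proof
    assume "?P (Suc m)"
    then have "Suc m \<le> m" unfolding m_def by (rule Greatest_le_nat[where b = M]) (use bounded in blast)
    then show False by simp
  qed
  then obtain d where d: "d < nt" "\<not> (\<exists>z\<in>OL. x d = p ^ Suc m * z)" by blast
  then have "\<not> p_dvd (y d)"
    using y[OF d(1)] by (auto simp: p_dvd_def)
  define h where "h = (LEAST d. \<not> p_dvd (y d))"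
  have "\<not> p_dvd (y h)" unfolding h_def by (rule LeastI[where P = "\<lambda>d. \<not> p_dvd (y d)"]) fact
  moreover have "p_dvd (y d)" if "d < h" for d
    using not_less_Least[of d "\<lambda>d. \<not> p_dvd (y d)"] that unfolding h_def by blast
  moreover have "h \<le> d" unfolding h_def by (rule Least_le) fact
  ultimately show ?thesis using y d(1) by (intro exI[of _ m] exI[of _ y] exI[of _ h]) auto
qed

end

section \<open>Determinants of codewords\<close>

lemma block_index:
  assumes "j < U" "b < nt"
  shows "j * nt + b < U * nt" "(j * nt + b) div nt = j" "(j * nt + b) mod nt = (b::nat)"
proof -
  have "j * nt + b < Suc j * nt" using assms by simp
  also have "\<dots> \<le> U * nt" using assms by (intro mult_le_mono1) simp
  finally show "j * nt + b < U * nt" .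
qed (use assms in auto)

lemma permutes_eqI:
  assumes "q permutes {0..<n}" "q' permutes {0..<n}" "\<And>i. i < n \<Longrightarrow> q i = q' i"
  shows "q = q'"
proof
  fix i show "q i = q' i"
    using assms(3)[of i] permutes_not_in[OF assms(1), of i] permutes_not_in[OF assms(2), of i]
    by (cases "i < n") auto
qed

text \<open>Position \<open>(r, c)\<close> of a block holds a conjugate of \<open>x\<^sub>d\<close> with \<open>d = diag_index nt r c\<close>, which is
  the difference of the row and column indices modulo \<open>nt\<close>.\<close>

definition diag_index :: "nat \<Rightarrow> nat \<Rightarrow> nat \<Rightarrow> nat"
  where "diag_index nt r c = (if c mod nt \<le> r mod nt then r mod nt - c mod nt else r mod nt + nt - c mod nt)"

lemma diag_index_less: "0 < nt \<Longrightarrow> diag_index nt r c < nt"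
  by (auto simp: diag_index_def less_imp_diff_less)

text \<open>A factor \<open>p\<close> occurs exactly where the cyclic difference of the indices
  wraps around. In this additive form the row and column residues cancel once summed over a
  permutation.\<close>

lemma diag_index_add:
  assumes "0 < nt"
  shows "nt * of_bool (r mod nt < c mod nt) + r mod nt = diag_index nt r c + c mod nt"
proof -
  have "c mod nt < nt" using assms by simp
  then show ?thesis by (auto simp: diag_index_def)
qed

locale multi_user_code = inert_extension K L \<sigma> n p for K L \<sigma> n p +
  fixes U nt k :: nat
  assumes n_eq: "n = U * nt" and k_pos: "0 < k"
begin

lemma U_pos: "0 < U" and nt_pos: "0 < nt"
  using n_pos n_eq by auto

lemma row_index:
  assumes "r < n" shows "r div nt < U" "r mod nt < nt"
  using assms nt_pos n_eq by (simp_all add: less_mult_imp_div_less mult.commute)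

text \<open>The entries of a stacked codeword, multiplied by \<open>p ^ k\<close>.\<close>

definition entry :: "(nat \<Rightarrow> nat \<Rightarrow> complex) \<Rightarrow> nat \<Rightarrow> nat \<Rightarrow> complex"
  where "entry x r c = p ^ ((if c div nt = r div nt then 0 else k) + of_bool (r mod nt < c mod nt)) *
    (\<sigma> ^^ (c div nt + U * (c mod nt))) (x (r div nt) (diag_index nt r c))"

abbreviation code_mat :: "(nat \<Rightarrow> nat \<Rightarrow> complex) \<Rightarrow> complex mat"
  where "code_mat x \<equiv> mat n n (\<lambda>(r, c). entry x r c)"

lemma entry_OL:
  assumes "\<And>j d. j < U \<Longrightarrow> d < nt \<Longrightarrow> x j d \<in> OL" "r < n"
  shows "entry x r c \<in> OL"
  unfolding entry_def using assms row_index
  by (intro O_mult OL_power p_OL funpow_OL) (auto simp: diag_index_less nt_pos)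

lemma det_code_mat_mem:
  assumes "\<And>j d. j < U \<Longrightarrow> d < nt \<Longrightarrow> x j d \<in> OL"
  shows "det (code_mat x) \<in> OL"
proof -
  have "det (code_mat x) = (\<Sum>q | q permutes {0..<n}. signof q * (\<Prod>r = 0..<n. entry x r (q r)))"
    by (subst det_def'[of _ n]) (auto simp: permutes_less intro!: sum.cong prod.cong arg_cong2[of _ _ _ _ "(*)"])
  also have "\<dots> \<in> OL"
    using entry_OL[OF assms] by (intro OL_sum O_mult OL_prod OL_signof) auto
  finally show ?thesis .
qed

lemma funpow_p_power [simp]: "(\<sigma> ^^ i) (p ^ m) = p ^ m"
  by (rule funpow_fixes_K) (simp add: p_K)

text \<open>In the Leibniz expansion the weighted exponents \<open>nt * e\<close> of \<open>p\<close> sum to at least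
  \<open>\<Sum> h\<close>, with equality only for the permutation that picks the leading coefficient
  \<open>x\<^sub>h\<close> in every row: the row and column indices cancel in the sum.\<close>

lemma det_code_mat_nonzero_normalized:
  assumes x: "\<And>j d. j < U \<Longrightarrow> d < nt \<Longrightarrow> x j d \<in> OL"
    and h: "\<And>j. j < U \<Longrightarrow> h j < nt" "\<And>j. j < U \<Longrightarrow> \<not> p_dvd (x j (h j))"
    and lower: "\<And>j d. j < U \<Longrightarrow> d < h j \<Longrightarrow> p_dvd (x j d)"
  shows "det (code_mat x) \<noteq> 0"
proof -
  have "\<exists>y. y \<in> OL \<and> x j d = p ^ of_bool (d < h j) * y" if "j < U" "d < nt" for j d
    using x[OF that] lower[OF that(1), of d] by (cases "d < h j") (auto simp: p_dvd_def)
  then obtain y where y: "\<And>j d. j < U \<Longrightarrow> d < nt \<Longrightarrow> y j d \<in> OL \<and> x j d = p ^ of_bool (d < h j) * y j d"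
    by metis
  \<comment> \<open>The power of \<open>p\<close> split off from an entry: twist, wrap-around, and
    one factor for each coefficient below the leading index. The cofactor is
    \<open>z\<close>.\<close>
  define e where "e r c = (if c div nt = r div nt then 0 else k) + of_bool (r mod nt < c mod nt) +
    of_bool (diag_index nt r c < h (r div nt))" for r c
  define z where "z r c = (\<sigma> ^^ (c div nt + U * (c mod nt))) (y (r div nt) (diag_index nt r c))" for r c
  have z_OL: "z r c \<in> OL" if "r < n" for r c
    unfolding z_def using y row_index[OF that] by (intro funpow_OL) (simp add: diag_index_less nt_pos)
  have entry: "entry x r c = p ^ e r c * z r c" if "r < n" for r c
    using y[of "r div nt" "diag_index nt r c"] row_index[OF that] nt_pos
    by (simp add: entry_def e_def z_def diag_index_less funpow_mult power_add)
  \<comment> \<open>By \<open>diag_index_add\<close> the left side minus the column residue is the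
    diagonal index \<open>d\<close> plus \<open>nt * k\<close> off the diagonal blocks and plus
    \<open>nt\<close> if \<open>d < h\<close>. Since \<open>h < nt\<close>, either extra summand
    overshoots \<open>h\<close>, so equality means \<open>d = h\<close> in a diagonal block.\<close>
  have exponent: "h (r div nt) + c mod nt \<le> nt * e r c + r mod nt"
    "nt * e r c + r mod nt = h (r div nt) + c mod nt \<longleftrightarrow> c div nt = r div nt \<and> diag_index nt r c = h (r div nt)"
    if "r < n" for r c
  proof -
    have "h (r div nt) < nt" using h(1) row_index[OF that] by blast
    moreover obtain w where "nt * k = w" "nt \<le> w" using k_pos by simp
    moreover have "nt * e r c + r mod nt = nt * (if c div nt = r div nt then 0 else k) +
        nt * of_bool (diag_index nt r c < h (r div nt)) + (nt * of_bool (r mod nt < c mod nt) + r mod nt)"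
      by (simp add: e_def algebra_simps)
    ultimately show "h (r div nt) + c mod nt \<le> nt * e r c + r mod nt"
      "nt * e r c + r mod nt = h (r div nt) + c mod nt \<longleftrightarrow> c div nt = r div nt \<and> diag_index nt r c = h (r div nt)"
      unfolding diag_index_add[OF nt_pos] by (auto simp: of_bool_def)
  qed
  \<comment> \<open>The column in the same block whose residue is that of \<open>r\<close> minus
    \<open>h\<close>, cyclically. Beyond \<open>n\<close> it is the identity, as
    \<open>permutes\<close> requires.\<close>
  define lead where "lead r = (if r < n then (r div nt) * nt +
    (if h (r div nt) \<le> r mod nt then r mod nt - h (r div nt) else r mod nt + nt - h (r div nt)) else r)" for r
  have lead: "lead r < n" "lead r div nt = r div nt" "diag_index nt r (lead r) = h (r div nt)"
    "r mod nt = (lead r mod nt + h (r div nt)) mod nt" if "r < n" for r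
  proof -
    let ?b = "if h (r div nt) \<le> r mod nt then r mod nt - h (r div nt) else r mod nt + nt - h (r div nt)"
    have hr: "h (r div nt) < nt" using h(1) row_index[OF that] by blast
    have b: "?b < nt" using hr row_index[OF that] by (auto simp: less_imp_diff_less)
    have lead: "lead r = r div nt * nt + ?b" using that by (simp add: lead_def)
    have "lead r mod nt = ?b" unfolding lead using block_index(3)[OF row_index(1)[OF that] b] .
    then show "diag_index nt r (lead r) = h (r div nt)" "r mod nt = (lead r mod nt + h (r div nt)) mod nt"
      using hr row_index[OF that] by (auto simp: diag_index_def)
    show "lead r < n" "lead r div nt = r div nt"
      unfolding lead n_eq using block_index(1,2)[OF row_index(1)[OF that] b] .
  qed
  have lead_unique: "c = lead r" if "r < n" "c div nt = r div nt" "diag_index nt r c = h (r div nt)" for r c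
  proof -
    obtain i l l' where il: "r mod nt = i" "c mod nt = l" "l < nt" "lead r mod nt = l'" "l' < nt"
      using nt_pos mod_less_divisor by blast
    have "diag_index nt r c = diag_index nt r (lead r)" using lead(3)[OF that(1)] that(3) by simp
    then have "c mod nt = lead r mod nt"
      using il unfolding diag_index_def by (auto split: if_splits)
    then show ?thesis
      using that(2) lead(2)[OF that(1)] by (metis div_mult_mod_eq)
  qed
  have lead_permutes: "lead permutes {0..<n}"
  proof (rule bij_imp_permutes)
    have "inj_on lead {0..<n}"
    proof (rule inj_onI)
      fix r r' assume r: "r \<in> {0..<n}" "r' \<in> {0..<n}" "lead r = lead r'"
      then have "r div nt = r' div nt" using lead(2)[of r] lead(2)[of r'] by simp
      moreover from this have "r mod nt = r' mod nt" using r lead(4)[of r] lead(4)[of r'] by simp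
      ultimately show "r = r'" by (metis div_mult_mod_eq)
    qed
    moreover have "lead ` {0..<n} \<subseteq> {0..<n}" using lead(1) by auto
    ultimately show "bij_betw lead {0..<n} {0..<n}"
      by (simp add: bij_betw_def endo_inj_surj)
  qed (simp add: lead_def)
  let ?E = "\<lambda>q. \<Sum>r = 0..<n. e r (q r)" and ?Z = "\<lambda>q. signof q * (\<Prod>r = 0..<n. z r (q r))"
  have leibniz_term: "signof q * (\<Prod>r = 0..<n. entry x r (q r)) = p ^ ?E q * ?Z q" for q
    by (simp add: entry prod.distrib power_sum mult_ac)
  have Z_OL: "?Z q \<in> OL" for q
    by (intro O_mult OL_signof OL_prod z_OL) simp
  have index_sum: "(\<Sum>r = 0..<n. q r mod nt) = (\<Sum>r = 0..<n. r mod nt)" if "q permutes {0..<n}" for q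
    using sum.permute[OF that, of "\<lambda>r. r mod nt"] by (simp add: comp_def)
  have min: "?E lead < ?E q" if q: "q permutes {0..<n}" "q \<noteq> lead" for q
  proof -
    have "(\<Sum>r = 0..<n. nt * e r (lead r) + r mod nt) = (\<Sum>r = 0..<n. h (r div nt) + lead r mod nt)"
    proof (intro sum.cong refl)
      fix r assume "r \<in> {0..<n}"
      then have "r < n" by simp
      then show "nt * e r (lead r) + r mod nt = h (r div nt) + lead r mod nt"
        using exponent(2)[of r "lead r"] lead(2,3)[of r] by blast
    qed
    then have "nt * ?E lead = (\<Sum>r = 0..<n. h (r div nt))"
      using index_sum[OF lead_permutes] by (simp add: sum.distrib sum_distrib_left)
    moreover obtain r0 where r0: "r0 < n" "q r0 \<noteq> lead r0"
      using permutes_eqI[OF q(1) lead_permutes] q(2) by blast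
    have "(\<Sum>r = 0..<n. h (r div nt) + q r mod nt) < (\<Sum>r = 0..<n. nt * e r (q r) + r mod nt)"
    proof (rule sum_strict_mono_ex1)
      show "\<exists>r\<in>{0..<n}. h (r div nt) + q r mod nt < nt * e r (q r) + r mod nt"
        using r0 exponent[OF r0(1), of "q r0"] lead_unique[OF r0(1), of "q r0"]
        by (intro bexI[of _ r0]) (auto simp: less_le)
    qed (use exponent(1) in auto)
    then have "(\<Sum>r = 0..<n. h (r div nt)) < nt * ?E q"
      using index_sum[OF q(1)] by (simp add: sum.distrib sum_distrib_left)
    ultimately have "nt * ?E lead < nt * ?E q" by simp
    then show ?thesis by (simp only: mult_less_cancel1)
  qed
  have "(\<Sum>q | q permutes {0..<n}. signof q * (\<Prod>r = 0..<n. entry x r (q r))) \<noteq> 0"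
  proof (rule sum_nonzero_of_unique_min)
    show "finite {q. q permutes {0..<n}}" by (rule finite_permutations) simp
    show "lead \<in> {q. q permutes {0..<n}}" using lead_permutes by simp
    show "signof lead * (\<Prod>r = 0..<n. entry x r (lead r)) = p ^ ?E lead * ?Z lead" by (rule leibniz_term)
    show "?Z lead \<in> OL" by (rule Z_OL)
    have "\<not> p_dvd (\<Prod>r = 0..<n. z r (lead r))"
    proof (rule not_p_dvd_prod)
      fix r assume "r \<in> {0..<n}"
      then have r: "r < n" by simp
      \<comment> \<open>At the leading index no factor \<open>p\<close> was split off, so
        \<open>z\<close> is a conjugate of \<open>x\<close> itself.\<close>
      have "z r (lead r) = (\<sigma> ^^ (lead r div nt + U * (lead r mod nt))) (x (r div nt) (h (r div nt)))"
        using y[of "r div nt" "h (r div nt)"] h(1) row_index[OF r] lead(2,3)[OF r] by (simp add: z_def)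
      then show "z r (lead r) \<in> OL \<and> \<not> p_dvd (z r (lead r))"
        using z_OL[OF r] p_dvd_funpow x h row_index[OF r] by metis
    qed
    then show "\<not> p_dvd (?Z lead)"
      using p_dvd_uminus by (auto simp: sign_def)
  next
    fix q assume "q \<in> {q. q permutes {0..<n}} - {lead}"
    then have "Suc (?E lead) \<le> ?E q" using min[of q] by (intro Suc_leI) simp
    then have "p ^ ?E q = p ^ Suc (?E lead) * p ^ (?E q - Suc (?E lead))"
      by (simp only: power_add[symmetric] le_add_diff_inverse)
    then have "p ^ ?E q * ?Z q = p ^ Suc (?E lead) * (p ^ (?E q - Suc (?E lead)) * ?Z q)"
      by (simp only: mult.assoc)
    moreover have "p ^ (?E q - Suc (?E lead)) * ?Z q \<in> OL"
      by (intro O_mult OL_power Z_OL p_OL)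
    ultimately show "\<exists>v\<in>OL. signof q * (\<Prod>r = 0..<n. entry x r (q r)) = p ^ Suc (?E lead) * v"
      unfolding leibniz_term by blast
  qed
  moreover have "det (code_mat x) = (\<Sum>q | q permutes {0..<n}. signof q * (\<Prod>r = 0..<n. entry x r (q r)))"
    by (subst det_def'[of _ n]) (auto simp: permutes_less intro!: sum.cong prod.cong arg_cong2[of _ _ _ _ "(*)"])
  ultimately show ?thesis by simp
qed

text \<open>Reduction to the normalized case: the rows of user \<open>j\<close> share a factor
  \<open>p ^ m j\<close>, and taking these factors out changes the determinant only by a nonzero
  number.\<close>

lemma det_code_mat_nonzero:
  assumes x: "\<And>j d. j < U \<Longrightarrow> d < nt \<Longrightarrow> x j d \<in> OL"
    and nonzero: "\<And>j. j < U \<Longrightarrow> \<exists>d<nt. x j d \<noteq> 0"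
  shows "det (code_mat x) \<noteq> 0"
proof -
  have "\<exists>m y h. h < nt \<and> (\<forall>d<nt. y d \<in> OL \<and> x j d = p ^ m * y d) \<and> \<not> p_dvd (y h) \<and> (\<forall>d<h. p_dvd (y d))"
    if "j < U" for j
    using nonzero[OF that] common_p_power[of nt "x j"] x[OF that] by blast
  then obtain m y h where y: "\<And>j. j < U \<Longrightarrow> h j < nt \<and> (\<forall>d<nt. y j d \<in> OL \<and> x j d = p ^ m j * y j d) \<and>
      \<not> p_dvd (y j (h j)) \<and> (\<forall>d<h j. p_dvd (y j d))"
    by metis
  have "entry x r c = p ^ m (r div nt) * entry y r c" if "r < n" for r c
    using y[OF row_index(1)[OF that]] nt_pos
    by (simp add: entry_def diag_index_less funpow_mult)
  then have "code_mat x = mat n n (\<lambda>(r, c). p ^ m (r div nt) * entry y (id r) (id c) * 1)"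
    by (intro eq_matI) auto
  then have "det (code_mat x) = (\<Prod>r<n. p ^ m (r div nt) * 1) * det (code_mat y)"
    using det_conjugate_permutation[OF permutes_id, of n "\<lambda>r. p ^ m (r div nt)" "entry y" "\<lambda>_. 1"] by simp
  moreover have "det (code_mat y) \<noteq> 0"
    by (rule det_code_mat_nonzero_normalized[of y h]) (use y in auto)
  ultimately show ?thesis using p_nonzero by simp
qed

text \<open>Applying \<open>\<sigma> ^ U\<close> to a codeword amounts to a simultaneous cyclic shift of the rows and the
  columns of every block, up to factors \<open>p\<close> that cancel in the determinant.\<close>

lemma det_code_mat_invariant:
  assumes x: "\<And>j d. j < U \<Longrightarrow> d < nt \<Longrightarrow> x j d \<in> OL"
  shows "(\<sigma> ^^ U) (det (code_mat x)) = det (code_mat x)"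
proof -
  interpret \<tau>: subfield_endo L "\<sigma> ^^ U" by (rule funpow_endo)
  define s where "s r = (if r < n then r div nt * nt + (if Suc (r mod nt) = nt then 0 else Suc (r mod nt)) else r)" for r
  have s: "s r < n" "s r div nt = r div nt" "s r mod nt = (if Suc (r mod nt) = nt then 0 else Suc (r mod nt))"
    if "r < n" for r
  proof -
    have "(if Suc (r mod nt) = nt then 0 else Suc (r mod nt)) < nt"
      using row_index(2)[OF that] by auto
    note * = block_index[OF row_index(1)[OF that] this]
    show "s r < n" "s r div nt = r div nt" "s r mod nt = (if Suc (r mod nt) = nt then 0 else Suc (r mod nt))"
      using * that unfolding s_def n_eq by simp_all
  qed
  have s_permutes: "s permutes {0..<n}"
  proof (rule bij_imp_permutes)
    have "inj_on s {0..<n}"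
    proof (rule inj_onI)
      fix r r' assume r: "r \<in> {0..<n}" "r' \<in> {0..<n}" "s r = s r'"
      then have "r div nt = r' div nt" using s(2)[of r] s(2)[of r'] by simp
      moreover have "r mod nt = r' mod nt" using r s(3)[of r] s(3)[of r'] by (auto split: if_splits)
      ultimately show "r = r'" by (metis div_mult_mod_eq)
    qed
    moreover have "s ` {0..<n} \<subseteq> {0..<n}" using s(1) by auto
    ultimately show "bij_betw s {0..<n} {0..<n}"
      by (simp add: bij_betw_def endo_inj_surj)
  qed (simp add: s_def)
  \<comment> \<open>The shift moves the last index of a block to 0. In the last row an entry
    acquires a spurious \<open>p\<close>, which \<open>a\<close> removes; in the last column it
    loses one, which \<open>b\<close> restores; at their intersection both cancel.\<close>
  define a where "a r = (if Suc (r mod nt) = nt then inverse p else 1)" for r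
  define b where "b c = (if Suc (c mod nt) = nt then p else 1)" for c
  have shift: "(\<sigma> ^^ U) (entry x r c) = a r * entry x (s r) (s c) * b c" if rc: "r < n" "c < n" for r c
  proof -
    obtain i l where il: "r mod nt = i" "i < nt" "c mod nt = l" "l < nt"
      using row_index rc by blast
    have diag: "diag_index nt (s r) (s c) = diag_index nt r c"
      using s(3)[OF rc(1)] s(3)[OF rc(2)] il unfolding diag_index_def by auto
    let ?x = "x (r div nt) (diag_index nt r c)"
    have xL: "?x \<in> L" using x row_index[OF rc(1)] by (auto simp: diag_index_less nt_pos)
    \<comment> \<open>In the last column the exponent increases to \<open>c div nt + n\<close>, and
      the \<open>n\<close>-th power of \<sigma> is the identity.\<close>
    have pow: "(\<sigma> ^^ (s c div nt + U * (s c mod nt))) ?x = (\<sigma> ^^ (U + (c div nt + U * (c mod nt)))) ?x"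
    proof (cases "Suc (c mod nt) = nt")
      case True
      then have "U * nt = U * Suc (c mod nt)" by simp
      then have "U + (c div nt + U * (c mod nt)) = c div nt + n"
        unfolding n_eq by simp
      then have "(\<sigma> ^^ (U + (c div nt + U * (c mod nt)))) ?x = (\<sigma> ^^ (c div nt)) ((\<sigma> ^^ n) ?x)"
        by (simp only: funpow_add comp_apply)
      then show ?thesis using True order[OF xL] s[OF rc(2)] by simp
    next
      case False
      then show ?thesis using s[OF rc(2)] by (simp add: algebra_simps)
    qed
    have exponent: "p ^ of_bool (r mod nt < c mod nt) = a r * p ^ of_bool (s r mod nt < s c mod nt) * b c"
      using s(3)[OF rc(1)] s(3)[OF rc(2)] il p_nonzero by (auto simp: a_def b_def)
    have "(\<sigma> ^^ U) (entry x r c) = p ^ (if c div nt = r div nt then 0 else k) *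
        p ^ of_bool (r mod nt < c mod nt) * (\<sigma> ^^ (U + (c div nt + U * (c mod nt)))) ?x"
      using xL by (simp add: entry_def \<tau>.mult power_add funpow_add)
    also have "\<dots> = a r * entry x (s r) (s c) * b c"
      unfolding exponent pow[symmetric] entry_def diag power_add
      using s(2)[OF rc(1)] s(2)[OF rc(2)] by simp
    finally show ?thesis .
  qed
  have "(\<sigma> ^^ U) (det (code_mat x)) = det (map_mat (\<sigma> ^^ U) (code_mat x))"
    using entry_OL[OF x] by (intro \<tau>.det(1)[of _ n]) auto
  also have "map_mat (\<sigma> ^^ U) (code_mat x) = mat n n (\<lambda>(r, c). a r * entry x (s r) (s c) * b c)"
    by (intro eq_matI) (auto simp: shift)
  also have "det \<dots> = (\<Prod>r<n. a r * b r) * det (code_mat x)"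
    by (rule det_conjugate_permutation[OF s_permutes])
  also have "(\<Prod>r<n. a r * b r) = 1"
    using p_nonzero by (intro prod.neutral) (simp add: a_def b_def)
  finally show ?thesis by simp
qed

lemma det_code_mat_norm_bound:
  assumes x: "\<And>j d. j < U \<Longrightarrow> d < nt \<Longrightarrow> x j d \<in> OL"
    and nonzero: "\<And>j. j < U \<Longrightarrow> \<exists>d<nt. x j d \<noteq> 0"
  shows "1 \<le> (\<Prod>i<U. cmod ((\<sigma> ^^ i) (det (code_mat x))))"
  using det_code_mat_mem[OF x] det_code_mat_nonzero[OF x nonzero] det_code_mat_invariant[OF x]
  by (rule orbit_prod_norm_ge_1)

end

section \<open>Galois groups of suitable extensions\<close>

lemma galois_group_mem_iff:
  "f \<in> carrier (galois_group L K) \<longleftrightarrow>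
    f \<in> extensional L \<and> bij_betw f L L \<and> (\<forall>x\<in>L. \<forall>y\<in>L. f (x * y) = f x * f y \<and> f (x + y) = f x + f y) \<and>
    f 1 = 1 \<and> (\<forall>x\<in>K. f x = x)"
  by (auto simp: galois_group_def Bij_def ring_iso_def Ring.ring_hom_def bij_betw_apply)

lemma galois_group_ops:
  "f \<in> carrier (galois_group L K) \<Longrightarrow> g \<in> carrier (galois_group L K) \<Longrightarrow>
    f \<otimes>\<^bsub>galois_group L K\<^esub> g = compose L f g"
  "\<one>\<^bsub>galois_group L K\<^esub> = (\<lambda>x\<in>L. x)"
  by (auto simp: galois_group_def BijGroup_def)

text \<open>\<open>generate\<close> admits group inverses, and \<open>m_inv\<close> defines these by
  a description. The inverse is exhibited as a function and its uniqueness checked directly.\<close>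

lemma galois_group_inv:
  assumes L: "complex_subfield L" and "K \<subseteq> L" and f: "f \<in> carrier (galois_group L K)"
  shows "inv\<^bsub>galois_group L K\<^esub> f = restrict (inv_into L f) L"
proof -
  interpret L: complex_subfield L by (rule L)
  let ?g = "restrict (inv_into L f) L"
  have bij: "bij_betw f L L" and ext: "f \<in> extensional L" and one: "f 1 = 1"
    and hom: "\<And>x y. x \<in> L \<Longrightarrow> y \<in> L \<Longrightarrow> f (x * y) = f x * f y"
      "\<And>x y. x \<in> L \<Longrightarrow> y \<in> L \<Longrightarrow> f (x + y) = f x + f y"
    and fix_K: "\<And>x. x \<in> K \<Longrightarrow> f x = x"
    using f by (auto simp: galois_group_mem_iff)
  have g: "?g x \<in> L" "f (?g x) = x" if "x \<in> L" for x
    using that bij by (auto simp: bij_betw_def f_inv_into_f inv_into_into)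
  have gf: "?g y = x" if "x \<in> L" "f x = y" for x y
    using that bij by (auto simp: bij_betw_def)
  have "?g \<in> carrier (galois_group L K)"
    unfolding galois_group_mem_iff
  proof (intro conjI ballI)
    show "bij_betw ?g L L"
      using bij_betw_inv_into[OF bij] by simp
    show "?g (x * y) = ?g x * ?g y" "?g (x + y) = ?g x + ?g y" if "x \<in> L" "y \<in> L" for x y
      using that g by (auto intro!: gf simp: hom simp del: restrict_apply)
    show "?g 1 = 1" using one by (intro gf) auto
    show "?g x = x" if "x \<in> K" for x using fix_K[OF that] that \<open>K \<subseteq> L\<close> by (intro gf) auto
  qed simp
  show ?thesis unfolding m_inv_def
  proof (rule the_equality)
    show "?g \<in> carrier (galois_group L K) \<and> f \<otimes>\<^bsub>galois_group L K\<^esub> ?g = \<one>\<^bsub>galois_group L K\<^esub> \<and>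
        ?g \<otimes>\<^bsub>galois_group L K\<^esub> f = \<one>\<^bsub>galois_group L K\<^esub>"
      using f \<open>?g \<in> _\<close> g gf bij by (auto simp: galois_group_ops compose_def fun_eq_iff bij_betw_apply simp del: restrict_apply)
         (auto simp: restrict_def)
  next
    fix h assume h: "h \<in> carrier (galois_group L K) \<and> f \<otimes>\<^bsub>galois_group L K\<^esub> h = \<one>\<^bsub>galois_group L K\<^esub> \<and>
        h \<otimes>\<^bsub>galois_group L K\<^esub> f = \<one>\<^bsub>galois_group L K\<^esub>"
    show "h = ?g"
    proof (rule extensionalityI)
      show "h \<in> extensional L" using h by (simp add: galois_group_mem_iff)
      fix x assume "x \<in> L"
      then have "f (h x) = x" "h x \<in> L"
        using h f by (auto simp: galois_group_ops compose_def galois_group_mem_iff bij_betw_apply restrict_def fun_eq_iff split: if_splits)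
      then show "h x = ?g x" by (metis gf)
    qed simp
  qed
qed

text \<open>By induction over \<open>generate\<close>, an element fixed by \<sigma> is fixed by the
  whole group, hence lies in the fixed field \<open>K\<close>.\<close>

lemma cyclic_extension_of_galois:
  assumes "cyclic_galois_extension d L K \<sigma>"
  shows "cyclic_extension K L \<sigma>"
proof -
  have K: "complex_subfield K" and L: "complex_subfield L" and KL: "K \<subseteq> L"
    and fixed: "{x \<in> L. \<forall>f \<in> carrier (galois_group L K). f x = x} = K"
    and \<sigma>: "\<sigma> \<in> carrier (galois_group L K)"
    and gen: "generate (galois_group L K) {\<sigma>} = carrier (galois_group L K)"
    using assms by (auto simp: cyclic_galois_extension_def galois_extension_def complex_subfield_def)
  have "x \<in> K" if x: "x \<in> L" "\<sigma> x = x" for x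
  proof -
    have "f x = x" if "f \<in> generate (galois_group L K) {\<sigma>}" for f
      using that
    proof (induction rule: generate.induct)
      case (inv h)
      moreover have "inj_on \<sigma> L" using \<sigma> by (auto simp: galois_group_mem_iff bij_betw_def)
      ultimately show ?case
        using x galois_group_inv[OF L KL \<sigma>] by (auto simp: inv_into_f_eq)
    next
      case (eng h1 h2)
      then show ?case using x unfolding gen by (simp add: galois_group_ops compose_def)
    qed (use x in \<open>auto simp: galois_group_ops\<close>)
    then show ?thesis using fixed gen x by blast
  qed
  then show ?thesis
    using K L KL \<sigma>
    by (intro cyclic_extension.intro subfield_endo.intro subfield_endo_axioms.intro cyclic_extension_axioms.intro)
       (auto simp: galois_group_mem_iff bij_betw_apply)
qed

lemma inert_extension_of_suitable:
  assumes "suitable U nt K L p \<sigma>"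
  shows "inert_extension K L \<sigma> (U * nt) p"
proof -
  have K: "imaginary_quadratic K" and cyclic: "cyclic_galois_extension (U * nt) L K \<sigma>"
    and inert: "inert_prime L K p"
    using assms by (auto simp: suitable_def)
  obtain \<alpha> where gen: "L = generate_field CC (insert (complex_of_real \<alpha>) K)"
    using assms by (auto simp: suitable_def)
  interpret cyclic_extension K L \<sigma>
    using cyclic by (rule cyclic_extension_of_galois)
  have \<alpha>: "complex_of_real \<alpha> \<in> L"
    unfolding gen by (rule generate_field.incl) simp
  have dim: "CC.dimension (U * nt) K L"
    using cyclic by (simp add: cyclic_galois_extension_def galois_extension_def)
  have prime_K: "primeideal (PIdl\<^bsub>ring_of_integers K\<^esub> p) (ring_of_integers K)"
    and prime_L: "primeideal (PIdl\<^bsub>ring_of_integers L\<^esub> p) (ring_of_integers L)"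
    and p: "p \<in> algebraic_ints K" "p \<noteq> 0"
    using inert by (auto simp: inert_prime_def)
  \<comment> \<open>\<open>primeideal\<close> carries the ring structure, so closure of the integers
    under sums and products is read off from the two prime ideals.\<close>
  note cring_K = primeideal.axioms(2)[OF prime_K] and cring_L = primeideal.axioms(2)[OF prime_L]
  have K_mult: "x * y \<in> algebraic_ints K" if "x \<in> algebraic_ints K" "y \<in> algebraic_ints K" for x y
    using cring.cring_simprules(5)[OF cring_K, of x y] that by simp
  have norm_ge_1: "1 \<le> cmod x" if "x \<in> algebraic_ints K" "x \<noteq> 0" for x
    using K K_mult that by (rule imaginary_quadratic_norm_ge_1)
  \<comment> \<open>If the absolute value were 1, \<open>cnj p\<close> would be the inverse of
    \<open>p\<close> and an integer of \<open>K\<close>, so the prime ideal of \<open>p\<close>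
    would contain 1.\<close>
  have "cmod p \<noteq> 1"
  proof
    assume "cmod p = 1"
    then have "p * cnj p = 1" by (simp add: complex_norm_square[symmetric])
    then have "cnj p = inverse p" by (metis inverse_unique)
    then have "cnj p \<in> K" using p by (simp add: algebraic_ints_def)
    then have "cnj p \<in> algebraic_ints K" using p by (simp add: algebraic_ints_def)
    then have "\<one>\<^bsub>ring_of_integers K\<^esub> \<in> PIdl\<^bsub>ring_of_integers K\<^esub> p"
      using \<open>p * cnj p = 1\<close> by (auto simp: cgenideal_def mult.commute intro!: exI[of _ "cnj p"])
    then have "PIdl\<^bsub>ring_of_integers K\<^esub> p = carrier (ring_of_integers K)"
      by (rule ideal.one_imp_carrier[OF primeideal.axioms(1)[OF prime_K]])
    then show False using primeideal.I_notcarr[OF prime_K] by simp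
  qed
  show ?thesis
  proof
    show "0 < U * nt" "\<And>x. x \<in> L \<Longrightarrow> (\<sigma> ^^ (U * nt)) x = x"
      using funpow_order[OF dim \<alpha> gen] by blast+
    show "x + y \<in> algebraic_ints L" "x * y \<in> algebraic_ints L" if "x \<in> algebraic_ints L" "y \<in> algebraic_ints L" for x y
      using cring.cring_simprules(1,5)[OF cring_L, of x y] that by simp_all
    show "1 \<le> cmod x" if "x \<in> algebraic_ints K" "x \<noteq> 0" for x
      using norm_ge_1 that by blast
    show "p \<in> algebraic_ints K" by fact
    show "1 < cmod p" using norm_ge_1[OF p] \<open>cmod p \<noteq> 1\<close> by simp
    show "(\<exists>w\<in>algebraic_ints L. x = p * w) \<or> (\<exists>w\<in>algebraic_ints L. y = p * w)"
      if xyz: "x \<in> algebraic_ints L" "y \<in> algebraic_ints L" "z \<in> algebraic_ints L" "x * y = p * z" for x y z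
    proof -
      have "x \<otimes>\<^bsub>ring_of_integers L\<^esub> y \<in> PIdl\<^bsub>ring_of_integers L\<^esub> p"
        using xyz by (auto simp: cgenideal_def mult.commute)
      then show ?thesis
        using primeideal.I_prime[OF prime_L, of x y] xyz by (auto simp: cgenideal_def mult.commute)
    qed
  qed
qed

context multi_user_code
begin

text \<open>In the diagonal block the scalar is the twist itself; elsewhere it cancels the factor
  \<open>p ^ k\<close> of \<open>entry\<close>.\<close>

lemma user_block_row_entry:
  assumes x: "\<And>d. d < nt \<Longrightarrow> x j d \<in> L" and "j < U" "i < nt" "c < n"
  shows "user_block_row U nt p \<sigma> (int k) j (user_matrix U nt p \<sigma> (x j)) $$ (i, c) =
    inverse (p ^ k) * entry x (j * nt + i) c"
proof -
  have c: "c div nt < U" "c mod nt < nt" using row_index[OF \<open>c < n\<close>] by auto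
  have y: "(\<sigma> ^^ m) (p * (\<sigma> ^^ l) (x j d)) = p * (\<sigma> ^^ m) ((\<sigma> ^^ l) (x j d))" if "d < nt" for m l d
    using x[OF that] by (simp add: funpow_mult)
  show ?thesis
    using assms(2-4) c p_nonzero n_eq
    by (auto simp: user_block_row_def user_matrix_def entry_def Let_def diag_index_def y funpow_add
        Nat.funpow_mult power_int_minus)
qed

end

section \<open>The decay function\<close>

lemma finite_family_bound:
  fixes g :: "'a \<Rightarrow> real"
  assumes "finite S"
  shows "\<exists>M>0. \<forall>s\<in>S. g s \<le> M"
proof (intro exI conjI ballI)
  show "0 < 1 + (\<Sum>s\<in>S. \<bar>g s\<bar>)" by (intro add_pos_nonneg sum_nonneg) auto
  fix s assume "s \<in> S"
  then have "\<bar>g s\<bar> \<le> (\<Sum>s\<in>S. \<bar>g s\<bar>)" using assms by (intro member_le_sum) auto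
  then show "g s \<le> 1 + (\<Sum>s\<in>S. \<bar>g s\<bar>)" by linarith
qed

text \<open>Bridges two views of coefficients: \<open>is_Z_basis\<close> speaks of extensional
  functions on \<open>{..<r}\<close>, a truncated lattice of arbitrary functions on all
  indices.\<close>

lemma int_comb_restrict: "int_comb m n r B (restrict b {..<r}) = int_comb m n r B b"
  by (auto simp: int_comb_def intro!: eq_matI sum.cong)

lemma int_comb_eq_iff:
  assumes "is_Z_basis m n r \<Lambda> B"
  shows "int_comb m n r B b = int_comb m n r B b' \<longleftrightarrow> (\<forall>h<r. b h = b' h)"
proof
  assume "int_comb m n r B b = int_comb m n r B b'"
  then have eq: "int_comb m n r B (restrict b {..<r}) = int_comb m n r B (restrict b' {..<r})"
    by (simp only: int_comb_restrict)
  have inj: "inj_on (int_comb m n r B) ({..<r} \<rightarrow>\<^sub>E UNIV)"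
    using assms by (auto simp: is_Z_basis_def bij_betw_def)
  have "restrict b {..<r} = restrict b' {..<r}"
    by (rule inj_onD[OF inj, OF eq]; simp)
  then show "\<forall>h<r. b h = b' h"
    by (metis lessThan_iff restrict_apply')
qed (auto simp: int_comb_def intro!: eq_matI sum.cong)

lemma int_comb_zero: "int_comb m n r B (\<lambda>_. 0) = 0\<^sub>m m n"
  by (intro eq_matI) (auto simp: int_comb_def)

lemma int_comb_eq_0_iff:
  assumes "is_Z_basis m n r \<Lambda> B"
  shows "int_comb m n r B b = 0\<^sub>m m n \<longleftrightarrow> (\<forall>h<r. b h = 0)"
  using int_comb_eq_iff[OF assms, of b "\<lambda>_. 0"] by (simp add: int_comb_zero)

lemma int_comb_mem:
  assumes "is_Z_basis m n r \<Lambda> B"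
  shows "int_comb m n r B b \<in> \<Lambda>"
proof -
  have "int_comb m n r B (restrict b {..<r}) \<in> \<Lambda>"
    using assms bij_betw_apply[of "int_comb m n r B" "{..<r} \<rightarrow>\<^sub>E UNIV" \<Lambda>] by (simp add: is_Z_basis_def)
  then show ?thesis by (simp only: int_comb_restrict)
qed

lemma stack_cong: "0 < nt \<Longrightarrow> (\<And>j. j < U \<Longrightarrow> A j = A' j) \<Longrightarrow> stack U nt A = stack U nt A'"
  by (auto simp: stack_def less_mult_imp_div_less intro!: eq_matI)

text \<open>This is \<open>truncated_lattice\<close> without the code record, so that it can be used
  inside locales.\<close>

definition box_combs :: "nat \<Rightarrow> nat \<Rightarrow> nat \<Rightarrow> (nat \<Rightarrow> complex mat) \<Rightarrow> nat \<Rightarrow> complex mat set"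
  where "box_combs m n r B N = {int_comb m n r B b | b. \<forall>h<r. - int N \<le> b h \<and> b h \<le> int N}"

lemma finite_box_combs: "finite (box_combs m n r B N)"
proof (rule finite_subset)
  show "box_combs m n r B N \<subseteq> int_comb m n r B ` ({..<r} \<rightarrow>\<^sub>E {- int N..int N})"
  proof
    fix Y assume "Y \<in> box_combs m n r B N"
    then obtain b where b: "Y = int_comb m n r B b" "\<forall>h<r. - int N \<le> b h \<and> b h \<le> int N"
      unfolding box_combs_def by blast
    then have "Y = int_comb m n r B (restrict b {..<r})" by (simp add: int_comb_restrict)
    moreover have "restrict b {..<r} \<in> {..<r} \<rightarrow>\<^sub>E {- int N..int N}" using b(2) by auto
    ultimately show "Y \<in> int_comb m n r B ` ({..<r} \<rightarrow>\<^sub>E {- int N..int N})" by blast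
  qed
qed (intro finite_imageI finite_PiE; simp)

text \<open>Makes \<open>Min\<close> meaningful. A family has values at infinitely many indices, but
  \<open>stack\<close> reads only those below \<open>U\<close>.\<close>

lemma finite_stacked:
  assumes "0 < nt" "\<And>j. j < U \<Longrightarrow> finite (S j)"
  shows "finite (stacked U nt S)"
proof (rule finite_subset)
  show "stacked U nt S \<subseteq> stack U nt ` (\<Pi>\<^sub>E j\<in>{..<U}. S j)"
  proof
    fix Y assume "Y \<in> stacked U nt S"
    then obtain A where A: "Y = stack U nt A" "\<forall>j<U. A j \<in> S j"
      unfolding stacked_def by blast
    then have "Y = stack U nt (restrict A {..<U})"
      using assms(1) by (auto intro: stack_cong)
    moreover have "restrict A {..<U} \<in> (\<Pi>\<^sub>E j\<in>{..<U}. S j)" using A(2) by auto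
    ultimately show "Y \<in> stack U nt ` (\<Pi>\<^sub>E j\<in>{..<U}. S j)" by blast
  qed
qed (use assms(2) in \<open>intro finite_imageI finite_PiE; simp\<close>)

context multi_user_code
begin

text \<open>Quantifying over every family \<open>y\<close> with \<open>y j = x\<close> describes one
  user through the joint \<open>entry\<close> before the vectors of the other users are
  chosen.\<close>

lemma user_code_entries:
  assumes "Y \<in> user_code U nt L p \<sigma> (int k) j" "j < U"
  shows "\<exists>x. (\<forall>d<nt. x d \<in> OL) \<and> (\<exists>d<nt. x d \<noteq> 0) \<and>
    (\<forall>y i c. y j = x \<longrightarrow> i < nt \<longrightarrow> c < n \<longrightarrow> Y $$ (i, c) = inverse (p ^ k) * entry y (j * nt + i) c)"
proof -
  obtain x where x: "Y = user_block_row U nt p \<sigma> (int k) j (user_matrix U nt p \<sigma> x)"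
      "\<forall>d<nt. x d \<in> OL" "\<exists>d<nt. x d \<noteq> 0"
    using assms(1) unfolding user_code_def ring_of_integers_ops by blast
  have "Y $$ (i, c) = inverse (p ^ k) * entry y (j * nt + i) c" if "y j = x" "i < nt" "c < n" for y i c
    using user_block_row_entry[of y j i c] x that assms(2) by simp
  with x show ?thesis by blast
qed

lemma user_code_entry_mem:
  assumes "Y \<in> user_code U nt L p \<sigma> (int k) j" "j < U" "i < nt" "c < n"
  shows "Y $$ (i, c) \<in> L"
proof -
  obtain x where x: "\<forall>d<nt. x d \<in> OL"
    "\<And>y i c. y j = x \<Longrightarrow> i < nt \<Longrightarrow> c < n \<Longrightarrow> Y $$ (i, c) = inverse (p ^ k) * entry y (j * nt + i) c"
    using user_code_entries[OF assms(1,2)] by blast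
  have "entry (\<lambda>_. x) (j * nt + i) c \<in> OL"
    using x(1) block_index(1)[OF assms(2,3)] by (intro entry_OL) (simp_all add: n_eq)
  then show ?thesis
    using x(2)[of "\<lambda>_. x"] assms(3,4) by (simp add: mult_mem inverse_mem power_mem)
qed

text \<open>Clearing denominators costs \<open>p ^ k\<close> in each of the \<open>n\<close> rows,
  and this again in each of the \<open>U\<close> conjugates.\<close>

lemma stack_user_code:
  assumes A: "\<And>j. j < U \<Longrightarrow> A j \<in> user_code U nt L p \<sigma> (int k) j"
  shows "1 \<le> cmod p ^ (k * n * U) * (\<Prod>i<U. cmod ((\<sigma> ^^ i) (det (stack U nt A))))"
    and "det (stack U nt A) \<noteq> 0"
proof -
  have "\<forall>j\<in>{..<U}. \<exists>x. (\<forall>d<nt. x d \<in> OL) \<and> (\<exists>d<nt. x d \<noteq> 0) \<and>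
      (\<forall>y i c. y j = x \<longrightarrow> i < nt \<longrightarrow> c < n \<longrightarrow> A j $$ (i, c) = inverse (p ^ k) * entry y (j * nt + i) c)"
    using user_code_entries[OF A] by blast
  from bchoice[OF this] obtain x where *: "\<forall>j\<in>{..<U}. (\<forall>d<nt. x j d \<in> OL) \<and> (\<exists>d<nt. x j d \<noteq> 0) \<and>
      (\<forall>y i c. y j = x j \<longrightarrow> i < nt \<longrightarrow> c < n \<longrightarrow> A j $$ (i, c) = inverse (p ^ k) * entry y (j * nt + i) c)"
    by blast
  then have x: "\<And>j d. j < U \<Longrightarrow> d < nt \<Longrightarrow> x j d \<in> OL" "\<And>j. j < U \<Longrightarrow> \<exists>d<nt. x j d \<noteq> 0"
    by blast+
  have A_entry: "A j $$ (i, c) = inverse (p ^ k) * entry x (j * nt + i) c" if "j < U" "i < nt" "c < n" for j i c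
    using * that by blast
  have "stack U nt A = inverse (p ^ k) \<cdot>\<^sub>m code_mat x"
    using row_index by (intro eq_matI) (auto simp: stack_def A_entry simp flip: n_eq)
  then have det: "det (stack U nt A) = inverse (p ^ k) ^ n * det (code_mat x)"
    by simp
  then show "det (stack U nt A) \<noteq> 0"
    using det_code_mat_nonzero[of x] x p_nonzero by simp
  have "det (stack U nt A) \<in> L"
    using det entry_OL x det_code_mat_mem[of x] by (auto intro!: mult_mem power_mem inverse_mem)
  have "det (code_mat x) = p ^ (k * n) * det (stack U nt A)"
    using p_nonzero by (simp add: det power_mult field_simps)
  then have "(\<sigma> ^^ i) (det (code_mat x)) = p ^ (k * n) * (\<sigma> ^^ i) (det (stack U nt A))" for i
    using \<open>det (stack U nt A) \<in> L\<close> by (simp add: funpow_mult)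
  then have "(\<Prod>i<U. cmod ((\<sigma> ^^ i) (det (code_mat x)))) =
      cmod p ^ (k * n * U) * (\<Prod>i<U. cmod ((\<sigma> ^^ i) (det (stack U nt A))))"
    by (simp add: norm_mult norm_power prod.distrib power_mult)
  then show "1 \<le> cmod p ^ (k * n * U) * (\<Prod>i<U. cmod ((\<sigma> ^^ i) (det (stack U nt A))))"
    using det_code_mat_norm_bound[of x] x by simp
qed

end

section \<open>The two estimates for codes with fixed lattice bases\<close>

locale lattice_code = multi_user_code K L \<sigma> n p U nt k for K L \<sigma> n p U nt k +
  fixes B :: "nat \<Rightarrow> nat \<Rightarrow> complex mat"
  assumes basis: "j < U \<Longrightarrow>
    is_Z_basis nt n (2 * U * nt\<^sup>2) (user_code U nt L p \<sigma> (int k) j \<union> {0\<^sub>m nt n}) (B j)"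
begin

abbreviation rank :: nat where "rank \<equiv> 2 * U * nt\<^sup>2"

abbreviation box :: "nat \<Rightarrow> nat \<Rightarrow> complex mat set"
  where "box j N \<equiv> box_combs nt n rank (B j) N - {0\<^sub>m nt n}"

lemma rank_pos: "0 < rank"
  using U_pos nt_pos by simp

lemma box_subset: "j < U \<Longrightarrow> Y \<in> box j N \<Longrightarrow> Y \<in> user_code U nt L p \<sigma> (int k) j"
  using int_comb_mem[OF basis] unfolding box_combs_def by blast

lemma basis_entry_mem:
  assumes "j < U" "h < rank" "i < nt" "c < n"
  shows "B j h $$ (i, c) \<in> L"
proof -
  have "B j h \<in> user_code U nt L p \<sigma> (int k) j \<union> {0\<^sub>m nt n}"
    using basis[OF assms(1)] assms(2) by (simp add: is_Z_basis_def)
  then show ?thesis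
    using user_code_entry_mem[of "B j h" j i c] assms by auto
qed

text \<open>The product of the \<open>U\<close> conjugates is bounded below by a constant, while
  each of the \<open>U - 1\<close> nontrivial ones is at most a constant times
  \<open>N ^ nt\<close>; this leaves the claimed size for the determinant.\<close>

lemma det_lower_bound:
  "\<exists>c>0. \<forall>N>0. \<forall>A. (\<forall>j<U. A j \<in> box j (if j = 0 then N else 1)) \<longrightarrow>
    c / real N ^ ((U - 1) * nt) \<le> cmod (det (stack U nt A))"
proof -
  let ?S = "{..<U} \<times> {..<U} \<times> {..<rank} \<times> {..<nt} \<times> {..<n}"
  \<comment> \<open>A common bound for all conjugates of all basis entries; through it the constant
    depends on the chosen bases.\<close>
  obtain M where M: "M > 0" "\<forall>s\<in>?S. (\<lambda>(m, j, h, i, c). cmod ((\<sigma> ^^ m) (B j h $$ (i, c)))) s \<le> M"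
    using finite_family_bound[of ?S] by blast
  define D where "D = fact n * (real rank * M) ^ n"
  define P where "P = cmod p ^ (k * n * U)"
  have "0 < D" "0 < P"
    using M(1) rank_pos p_nonzero by (simp_all add: D_def P_def)
  have "1 / (P * D ^ (U - 1)) / real N ^ ((U - 1) * nt) \<le> cmod (det (stack U nt A))"
    if "0 < N" and A: "\<And>j. j < U \<Longrightarrow> A j \<in> box j (if j = 0 then N else 1)" for N A
  proof -
    have code: "A j \<in> user_code U nt L p \<sigma> (int k) j" if "j < U" for j
      using box_subset A that by blast
    have "\<exists>b. A j = int_comb nt n rank (B j) b \<and> (\<forall>h<rank. \<bar>b h\<bar> \<le> int (if j = 0 then N else 1))"
      if "j < U" for j
      using A[OF that] unfolding box_combs_def by (auto simp: abs_le_iff minus_le_iff)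
    then obtain b where b: "\<And>j. j < U \<Longrightarrow> A j = int_comb nt n rank (B j) (b j)"
        "\<And>j h. j < U \<Longrightarrow> h < rank \<Longrightarrow> \<bar>b j h\<bar> \<le> int (if j = 0 then N else 1)"
      by metis
    have stack_entry: "stack U nt A $$ (r, c) = A (r div nt) $$ (r mod nt, c)" if "r < n" "c < n" for r c
      using that by (simp add: stack_def n_eq)
    have mem: "stack U nt A $$ (r, c) \<in> L" if "r < n" "c < n" for r c
      using user_code_entry_mem[OF code] row_index that by (simp add: stack_entry)
    have carrier: "stack U nt A \<in> carrier_mat n n"
      by (simp add: stack_def n_eq)
    have conj_bound: "cmod ((\<sigma> ^^ m) (det (stack U nt A))) \<le> D * real N ^ nt" if "m < U" for m
    proof -
      interpret fm: subfield_endo L "\<sigma> ^^ m" by (rule funpow_endo)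
      \<comment> \<open>Only the first \<open>nt\<close> rows, those of the first user, grow with
        \<open>N\<close>; all other rows have coefficients of absolute value at most 1.\<close>
      let ?R = "\<lambda>r. (if r < nt then real N else 1) * (real rank * M)"
      have "cmod (det (map_mat (\<sigma> ^^ m) (stack U nt A))) \<le> fact n * (\<Prod>r = 0..<n. ?R r)"
      proof (rule norm_det_le_rows)
        show "map_mat (\<sigma> ^^ m) (stack U nt A) \<in> carrier_mat n n" using carrier by simp
        fix r c assume rc: "r < n" "c < n"
        define j i where "j = r div nt" and "i = r mod nt"
        have ji: "j < U" "i < nt" using row_index[OF rc(1)] by (simp_all add: j_def i_def)
        have "map_mat (\<sigma> ^^ m) (stack U nt A) $$ (r, c) =
            (\<sigma> ^^ m) (\<Sum>h<rank. of_int (b j h) * B j h $$ (i, c))"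
          using carrier rc ji b(1)[OF ji(1)] by (simp add: stack_entry int_comb_def flip: j_def i_def)
        also have "\<dots> = (\<Sum>h<rank. of_int (b j h) * (\<sigma> ^^ m) (B j h $$ (i, c)))"
          using basis_entry_mem ji rc by (subst fm.sum) (auto simp: fm.mult)
        finally have "cmod (map_mat (\<sigma> ^^ m) (stack U nt A) $$ (r, c)) \<le>
            (\<Sum>h<rank. cmod (of_int (b j h) * (\<sigma> ^^ m) (B j h $$ (i, c))))"
          by (simp add: norm_sum)
        also have "\<dots> \<le> (\<Sum>h<rank. (if r < nt then real N else 1) * M)"
        proof (rule sum_mono)
          fix h assume "h \<in> {..<rank}"
          then have h: "h < rank" by simp
          have "j = 0 \<longleftrightarrow> r < nt" using nt_pos by (simp add: j_def div_eq_0_iff)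
          then have "\<bar>real_of_int (b j h)\<bar> \<le> (if r < nt then real N else 1)"
            using b(2)[OF ji(1) h] by (auto simp flip: of_int_abs simp: of_int_le_iff split: if_splits)
          moreover have "cmod ((\<sigma> ^^ m) (B j h $$ (i, c))) \<le> M"
            using bspec[OF M(2), of "(m, j, h, i, c)"] \<open>m < U\<close> ji h rc by simp
          ultimately show "cmod (of_int (b j h) * (\<sigma> ^^ m) (B j h $$ (i, c))) \<le> (if r < nt then real N else 1) * M"
            unfolding norm_mult norm_of_int by (intro mult_mono) auto
        qed
        also have "\<dots> = ?R r" by simp
        finally show "cmod (map_mat (\<sigma> ^^ m) (stack U nt A) $$ (r, c)) \<le> ?R r" .
      qed
      also have "(\<Prod>r = 0..<n. ?R r) = (\<Prod>r = 0..<n. if r < nt then real N else 1) * (real rank * M) ^ n"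
        by (simp add: prod.distrib)
      also have "(\<Prod>r = 0..<n. if r < nt then real N else 1) = (\<Prod>r = 0..<nt. real N)"
        using U_pos by (intro prod.mono_neutral_cong_right) (auto simp: n_eq)
      also have "det (map_mat (\<sigma> ^^ m) (stack U nt A)) = (\<sigma> ^^ m) (det (stack U nt A))"
        by (rule fm.det(1)[OF carrier, symmetric]) (rule mem)
      finally show ?thesis by (simp add: D_def mult_ac)
    qed
    define d where "d = cmod (det (stack U nt A))"
    have "1 \<le> P * (\<Prod>i<U. cmod ((\<sigma> ^^ i) (det (stack U nt A))))"
      using stack_user_code(1)[of A] code by (simp add: P_def)
    \<comment> \<open>The factor \<open>i = 0\<close> is the determinant itself and is kept; the
      others are replaced by their bound.\<close>
    also have "(\<Prod>i<U. cmod ((\<sigma> ^^ i) (det (stack U nt A)))) =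
        d * (\<Prod>i<U - 1. cmod ((\<sigma> ^^ Suc i) (det (stack U nt A))))"
      using U_pos by (cases U) (simp_all add: d_def prod.lessThan_Suc_shift del: prod.lessThan_Suc)
    also have "P * (d * (\<Prod>i<U - 1. cmod ((\<sigma> ^^ Suc i) (det (stack U nt A))))) \<le>
        P * (d * (\<Prod>i<U - 1. D * real N ^ nt))"
      using \<open>0 < P\<close> by (intro mult_left_mono prod_mono) (auto simp: d_def intro: conj_bound simp del: funpow.simps)
    finally have "1 \<le> d * (P * D ^ (U - 1) * real N ^ ((U - 1) * nt))"
      by (simp add: power_mult_distrib power_mult[symmetric] mult_ac)
    then show ?thesis
      using \<open>0 < N\<close> \<open>0 < P\<close> \<open>0 < D\<close> by (simp add: d_def field_simps)
  qed
  moreover have "0 < 1 / (P * D ^ (U - 1))" using \<open>0 < P\<close> \<open>0 < D\<close> by simp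
  ultimately show ?thesis by blast
qed

text \<open>The other users send fixed basis elements. Multiplying the stack by the inverse \<open>Z\<close> of one
  such stack turns the rows of the other users into unit vectors, so that the codeword of the
  first user enters the determinant only through \<open>nt\<^sup>2\<close> complex linear forms, which a pigeonhole
  argument makes small simultaneously.\<close>

lemma det_upper_bound:
  "\<exists>c>0. \<forall>N>0. \<exists>A. (\<forall>j<U. A j \<in> box j (if j = 0 then N else 1)) \<and>
    cmod (det (stack U nt A)) \<le> c / real N ^ ((U - 1) * nt)"
proof -
  \<comment> \<open>The first basis matrix of each lattice, nonzero because a Z-basis represents 0
    only trivially.\<close>
  define Y where "Y j = int_comb nt n rank (B j) (\<lambda>h. of_bool (h = 0))" for j
  have Y_box: "Y j \<in> box j 1" if "j < U" for j
    using int_comb_eq_0_iff[OF basis[OF that], of "\<lambda>h. of_bool (h = 0)"] rank_pos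
    unfolding box_combs_def Y_def by (auto intro!: exI[of _ "\<lambda>h. of_bool (h = 0)"])
  define A0 where "A0 = stack U nt Y"
  have A0: "A0 \<in> carrier_mat n n" by (simp add: A0_def stack_def n_eq)
  have "det A0 \<noteq> 0"
    unfolding A0_def using Y_box box_subset by (intro stack_user_code(2)) blast
  then obtain Z where Z: "Z \<in> carrier_mat n n" "A0 * Z = 1\<^sub>m n"
    using det_non_zero_imp_unit[OF A0, of "()"] by (auto simp: Units_def ring_mat_def)
  have det_Z: "det A0 * det Z = 1"
    using det_mult[OF A0 Z(1)] Z(2) by simp
  define I where "I = {..<nt} \<times> {..<nt}"
  \<comment> \<open>The entry \<open>(i, c)\<close> of \<open>B 0 h * Z\<close>. Only the columns
    \<open>c < nt\<close> are controlled, which leaves \<open>nt ^ 2\<close> complex forms for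
    \<open>2 * U * nt ^ 2\<close> integer unknowns and so the exponent \<open>U - 1\<close>.\<close>
  define g where "g = (\<lambda>(i, c) h. \<Sum>q<n. B 0 h $$ (i, q) * Z $$ (q, c))"
  have I: "finite I" "I \<noteq> {}" "rank = 2 * U * card I"
    using nt_pos by (auto simp: I_def power2_eq_square)
  obtain C where C: "C > 0" "\<And>N. N > 0 \<Longrightarrow> \<exists>b :: nat \<Rightarrow> int. (\<forall>h<rank. \<bar>b h\<bar> \<le> int N) \<and> (\<exists>h<rank. b h \<noteq> 0) \<and>
      (\<forall>i\<in>I. cmod (\<Sum>h<rank. of_int (b h) * g i h) \<le> C / real N ^ (U - 1))"
    using small_values_of_linear_forms[OF I(1,2) U_pos I(3), of g] by blast
  have "\<exists>A. (\<forall>j<U. A j \<in> box j (if j = 0 then N else 1)) \<and>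
      cmod (det (stack U nt A)) \<le> fact n * C ^ nt * cmod (det A0) / real N ^ ((U - 1) * nt)" if N: "0 < N" for N
  proof -
    obtain b :: "nat \<Rightarrow> int" where b: "\<forall>h<rank. \<bar>b h\<bar> \<le> int N" "\<exists>h<rank. b h \<noteq> 0"
        "\<forall>i\<in>I. cmod (\<Sum>h<rank. of_int (b h) * g i h) \<le> C / real N ^ (U - 1)"
      using C(2)[OF N] by blast
    define A where "A j = (if j = 0 then int_comb nt n rank (B 0) b else Y j)" for j
    have "int_comb nt n rank (B 0) b \<in> box 0 N"
      using b(1,2) int_comb_eq_0_iff[OF basis[OF U_pos], of b] unfolding box_combs_def
      by (auto simp: abs_le_iff minus_le_iff)
    then have "\<forall>j<U. A j \<in> box j (if j = 0 then N else 1)"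
      using Y_box by (simp add: A_def)
    moreover have "cmod (det (stack U nt A)) \<le> fact n * C ^ nt * cmod (det A0) / real N ^ ((U - 1) * nt)"
    proof -
      have carrier: "stack U nt A \<in> carrier_mat n n" by (simp add: stack_def n_eq)
      have "cmod (det (stack U nt A * Z)) \<le> fact n * (C / real N ^ (U - 1)) ^ nt"
      proof (rule norm_det_le_corner)
        show "stack U nt A * Z \<in> carrier_mat n n" using carrier Z by simp
        show "nt \<le> n" using U_pos by (simp add: n_eq)
        show "0 \<le> C / real N ^ (U - 1)" using C(1) by simp
        fix i c assume ic: "i < nt" "c < nt"
        with \<open>nt \<le> n\<close> have "i < n" "c < n" by simp_all
        then have "(stack U nt A * Z) $$ (i, c) = (\<Sum>q<n. stack U nt A $$ (i, q) * Z $$ (q, c))"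
          using carrier Z by (simp add: scalar_prod_def lessThan_atLeast0)
        also have "\<dots> = (\<Sum>q<n. \<Sum>h<rank. of_int (b h) * (B 0 h $$ (i, q) * Z $$ (q, c)))"
          using ic \<open>i < n\<close> by (intro sum.cong refl) (simp add: stack_def A_def int_comb_def n_eq sum_distrib_right mult.assoc)
        also have "\<dots> = (\<Sum>h<rank. of_int (b h) * g (i, c) h)"
          by (subst sum.swap) (simp add: g_def sum_distrib_left)
        finally show "cmod ((stack U nt A * Z) $$ (i, c)) \<le> C / real N ^ (U - 1)"
          using b(3) ic by (simp add: I_def)
      next
        fix r c assume rc: "nt \<le> r" "r < n" "c < n"
        \<comment> \<open>Below the first user the stack agrees with \<open>A0\<close>, so its
          product with \<open>Z\<close> has rows of the identity there.\<close>
        then have "0 < r div nt" using nt_pos by (simp add: div_greater_zero_iff)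
        then have "row (stack U nt A) r = row A0 r"
          using rc by (intro eq_vecI) (simp_all add: A0_def stack_def A_def n_eq)
        then have "(stack U nt A * Z) $$ (r, c) = (A0 * Z) $$ (r, c)"
          using rc carrier A0 Z(1) by simp
        then show "(stack U nt A * Z) $$ (r, c) = of_bool (r = c)"
          using rc by (simp add: Z(2))
      qed
      then have "cmod (det (stack U nt A * Z)) * cmod (det A0) \<le> fact n * (C / real N ^ (U - 1)) ^ nt * cmod (det A0)"
        by (rule mult_right_mono) simp
      moreover have "det (stack U nt A * Z) * det A0 = det (stack U nt A)"
        using det_mult[OF carrier Z(1)] det_Z by (simp add: mult.assoc mult.commute[of "det Z"])
      ultimately show ?thesis
        unfolding power_mult by (simp add: power_divide mult_ac flip: norm_mult)
    qed
    ultimately show ?thesis by blast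
  qed
  moreover have "0 < fact n * C ^ nt * cmod (det A0)" using C(1) \<open>det A0 \<noteq> 0\<close> by simp
  ultimately show ?thesis by blast
qed

end

theorem corollary5p5:
  fixes U nt :: nat and C :: mac_code
  assumes "U > 0" and "nt > 0"
    and "C \<in> code_family U nt"
  shows "\<exists>c1 > 0. \<exists>c2 > 0. \<forall>N::nat. N > 0 \<longrightarrow>
    c1 / real N ^ ((U - 1) * nt) \<le> decay U nt C (\<lambda>j. if j = 0 then N else 1) \<and>
    decay U nt C (\<lambda>j. if j = 0 then N else 1) \<le> c2 / real N ^ ((U - 1) * nt)"
proof -
  define k where "k = nat (twist_exp C)"
  \<comment> \<open>Turns the lower bound on the integer \<open>twist_exp C\<close> into positivity,
    so that it can be replaced by a natural number \<open>k\<close>.\<close>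
  have "0 \<le> real U * (real nt - 1) / 2" using assms(1,2) by simp
  then have "0 < twist_exp C" using assms(3) by (simp add: code_family_def)
  then have k: "0 < k" "twist_exp C = int k" by (simp_all add: k_def)
  interpret inert_extension "base_field C" "ext_field C" "gal_gen C" "U * nt" "inert_elt C"
    using assms(3) by (intro inert_extension_of_suitable) (simp add: code_family_def)
  interpret lattice_code "base_field C" "ext_field C" "gal_gen C" "U * nt" "inert_elt C" U nt k "lattice_basis C"
    using assms(3) k by unfold_locales (auto simp: code_family_def user_lattice_def code_of_user_def)
  have box: "truncated_lattice U nt C j N - {0\<^sub>m nt (U * nt)} = box j N" for j N
    by (simp add: truncated_lattice_def box_combs_def)
  let ?Ns = "\<lambda>N j. if j = 0 then N else 1 :: nat"
  define S where "S N = (\<lambda>A. cmod (det A)) ` stacked U nt (\<lambda>j. box j (?Ns N j))" for N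
  have decay: "decay U nt C (?Ns N) = Min (S N)" for N
    by (simp only: decay_def box S_def)
  have "finite (S N)" for N
    unfolding S_def using assms(2) by (intro finite_imageI finite_stacked finite_Diff finite_box_combs)
  obtain c1 where c1: "0 < c1" "\<And>N A. 0 < N \<Longrightarrow> \<forall>j<U. A j \<in> box j (?Ns N j) \<Longrightarrow>
      c1 / real N ^ ((U - 1) * nt) \<le> cmod (det (stack U nt A))"
    using det_lower_bound by blast
  obtain c2 where c2: "0 < c2" "\<And>N. 0 < N \<Longrightarrow> \<exists>A. (\<forall>j<U. A j \<in> box j (?Ns N j)) \<and>
      cmod (det (stack U nt A)) \<le> c2 / real N ^ ((U - 1) * nt)"
    using det_upper_bound by blast
  have "c1 / real N ^ ((U - 1) * nt) \<le> Min (S N) \<and> Min (S N) \<le> c2 / real N ^ ((U - 1) * nt)" if N: "0 < N" for N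
  proof
    obtain A where A: "\<forall>j<U. A j \<in> box j (?Ns N j)" "cmod (det (stack U nt A)) \<le> c2 / real N ^ ((U - 1) * nt)"
      using c2(2)[OF N] by blast
    then have in_S: "cmod (det (stack U nt A)) \<in> S N"
      unfolding S_def stacked_def by blast
    show "Min (S N) \<le> c2 / real N ^ ((U - 1) * nt)"
      by (rule order_trans[OF Min_le[OF \<open>finite (S N)\<close> in_S] A(2)])
    have "c1 / real N ^ ((U - 1) * nt) \<le> v" if "v \<in> S N" for v
      using that c1(2)[OF N] unfolding S_def stacked_def by blast
    \<comment> \<open>The witness of the upper bound shows that \<open>S N\<close> is nonempty, so
      the minimum is attained.\<close>
    moreover have "Min (S N) \<in> S N" using \<open>finite (S N)\<close> in_S by (intro Min_in) auto
    ultimately show "c1 / real N ^ ((U - 1) * nt) \<le> Min (S N)" .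
  qed
  then show ?thesis unfolding decay using c1(1) c2(1) by blast
qed

end
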